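(* Let $\mathfrak k$ be a field and $s\in\mathfrak k^*$. (1) Let $A$ be a unital associative $\mathfrak k$-algebra with elements $\sigma_k(x)\in A$ ($k\ge 1$, $x\in X$), where $X\subset \mathfrak k^*$ contains $s^j$ for all $j\ge 1$, satisfying the trigonometric Yang–Baxter equation $$\sigma_{k+1}(x)\sigma_{k}(xy)\sigma_{k+1}(y)=\sigma_{k}(y)\sigma_{k+1}(xy)\sigma_{k}(x)\qquad (x,y,xy\in X,\ k\ge 1)$$ and the locality condition $\sigma_k(x)\sigma_l(y)=\sigma_l(y)\sigma_k(x)$ for $|k-l|>1$. Then the multiplicative shuffles ${}^{s}\mathrm{Sh}_{m,n}$ (defined in the context) satisfy $${}^{s}\mathrm{Sh}_{n+k,m}\;({}^{s}\mathrm{Sh}_{k,n})^{\uparrow m}={}^{s}\mathrm{Sh}_{k,m+n}\;{}^{s}\mathrm{Sh}_{n,m}\qquad\text{for all } m,n,k\in\mathbb Z_{\ge 0}.$$ (2) Let $V$ be a $\mathfrak k$-vector space, let $X\subset\mathfrak k^*$ contain $s^j$ for all $j\ge 1$, and suppose the $\sigma_k(x)$ are given by a local representation: $\sigma_k(x)=\mathrm{Id}^{\otimes(k-1)}\otimes\sigma(x)$ (tensored with identities on the right) for a family $\sigma(x)\in\mathrm{End}(V\otimes V)$, $x\in X$, such that the trigonometric Yang–Baxter equation $\sigma_{k+1}(x)\sigma_{k}(xy)\sigma_{k+1}(y)=\sigma_{k}(y)\sigma_{k+1}(xy)\sigma_{k}(x)$ holds for all $k\ge 1$ and all $x,y\in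 X$ with $xy\in X$. For $u\in V^{\otimes m}$ and $v\in V^{\otimes n}$ put $$u\odot v:={}^{s}\mathrm{Sh}_{n,m}(u\otimes v)\in V^{\otimes(m+n)}.$$ Then $\bigoplus_{j\ge 0}V^{\otimes j}$ with the product $\odot$ is an associative graded algebra with identity element $1\in\mathfrak k=V^{\otimes 0}$, and $\bigoplus_{j\ge 0}\mathrm{Im}({}^{s}\Sigma_j)$ is a graded subalgebra of it.
   Context: For $m,n\ge 1$ the multiplicative shuffle is the ordered product $${}^{s}\mathrm{Sh}_{m,n}=\Bigl(\sigma_m(s)\sigma_{m+1}(s^2)\cdots\sigma_{m+n-1}(s^n)\Bigr)\Bigl(\sigma_{m-1}(s^2)\sigma_m(s^3)\cdots\sigma_{m+n-2}(s^{n+1})\Bigr)\cdots\Bigl(\sigma_1(s^m)\sigma_2(s^{m+1})\cdots\sigma_n(s^{m+n-1})\Bigr),$$ i.e. the product over $i=1,\dots,m$ (from left to right) of the brackets $\sigma_{m+1-i}(s^{i})\sigma_{m+2-i}(s^{i+1})\cdots\sigma_{m+n-i}(s^{n+i-1})$; and ${}^{s}\mathrm{Sh}_{m,0}={}^{s}\mathrm{Sh}_{0,m}=1$. Further ${}^{s}\Sigma_0={}^{s}\Sigma_1=1$ and $${}^{s}\Sigma_m=\Bigl(\sigma_1(s)\sigma_2(s^2)\cdots\sigma_{m-1}(s^{m-1})\Bigr)\Bigl(\sigma_1(s)\cdots\sigma_{m-2}(s^{m-2})\Bigr)\cdots\Bigl(\sigma_1(s)\Bigr)\qquad (m\ge 2).$$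 For an expression $w$ in the $\sigma_k(x)$, $w^{\uparrow \ell}$ denotes the same expression with every $\sigma_k(x)$ replaced by $\sigma_{k+\ell}(x)$. In a local representation, ${}^{s}\mathrm{Sh}_{m,n}$ is regarded as an operator on $V^{\otimes(m+n)}$ and ${}^{s}\Sigma_m$ as an operator on $V^{\otimes m}$. The algebras in (2) are called b-shuffle algebras. *)

theory Defs
  imports Complex_Main "HOL-Library.Function_Algebras"
begin

text \<open>Words in the letters \<open>\<sigma>\<^sub>k(x)\<close>, with \<open>(k, x)\<close> standing for \<open>\<sigma>\<^sub>k(x)\<close>. The \<open>j\<close>-th letter of the
  \<open>i\<close>-th bracket of the shuffle is \<open>\<sigma>\<close> with index \<open>m + j - i\<close> and argument \<open>s\<close> to the power
  \<open>i + j - 1\<close>; as \<open>1 \<le> i \<le> m\<close> and \<open>1 \<le> j\<close>, neither subtraction truncates.\<close>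

definition shuffle_word :: "'k::monoid_mult \<Rightarrow> nat \<Rightarrow> nat \<Rightarrow> (nat \<times> 'k) list" where
  "shuffle_word s m n =
     concat (map (\<lambda>i. map (\<lambda>j. (m + j - i, s ^ (i + j - 1))) [1..<Suc n]) [1..<Suc m])"

definition Sigma_word :: "'k::monoid_mult \<Rightarrow> nat \<Rightarrow> (nat \<times> 'k) list" where
  "Sigma_word s m = concat (map (\<lambda>r. map (\<lambda>j. (j, s ^ j)) [1..<r]) (rev [2..<Suc m]))"

definition shift_word :: "nat \<Rightarrow> (nat \<times> 'k) list \<Rightarrow> (nat \<times> 'k) list" where
  "shift_word l w = map (\<lambda>(k, x). (k + l, x)) w"

definition word_prod :: "(nat \<Rightarrow> 'k \<Rightarrow> 'a::monoid_mult) \<Rightarrow> (nat \<times> 'k) list \<Rightarrow> 'a" where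
  "word_prod \<sigma> w = prod_list (map (\<lambda>(k, x). \<sigma> k x) w)"

text \<open>The same for operators, multiplied by composition: the rightmost letter acts first.\<close>

definition word_op :: "(nat \<Rightarrow> 'k \<Rightarrow> 'a \<Rightarrow> 'a) \<Rightarrow> (nat \<times> 'k) list \<Rightarrow> 'a \<Rightarrow> 'a" where
  "word_op \<sigma> w = foldr (\<lambda>(k, x). \<sigma> k x) w"

text \<open>The sort \<open>{ring, monoid_mult}\<close> is that of unital associative rings; unlike \<open>ring_1\<close> it admits
  the zero ring.\<close>

locale unital_algebra = vector_space scale
  for scale :: "'k::field \<Rightarrow> 'a::{ring, monoid_mult} \<Rightarrow> 'a" +
  assumes scale_mult_left: "scale c a * b = scale c (a * b)"
    and scale_mult_right: "a * scale c b = scale c (a * b)"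

text \<open>An algebra on a subspace \<open>A\<close> of an ambient vector space, graded by the subspaces \<open>G i\<close>.\<close>

locale graded_algebra = vector_space scale
  for scale :: "'k::field \<Rightarrow> 'a::ab_group_add \<Rightarrow> 'a" +
  fixes A :: "'a set" and G :: "nat \<Rightarrow> 'a set"
    and mult :: "'a \<Rightarrow> 'a \<Rightarrow> 'a" and one :: 'a
  assumes subspace_A: "subspace A"
    and subspace_G: "subspace (G i)"
    and G_subset: "G i \<subseteq> A"
    and decomposition: "a \<in> A \<Longrightarrow>
      \<exists>!c. (\<forall>i. c i \<in> G i) \<and> finite {i. c i \<noteq> 0} \<and> a = (\<Sum>i | c i \<noteq> 0. c i)"
    and mult_closed: "a \<in> A \<Longrightarrow> b \<in> A \<Longrightarrow> mult a b \<in> A"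
    and mult_add_left: "a \<in> A \<Longrightarrow> a' \<in> A \<Longrightarrow> b \<in> A \<Longrightarrow> mult (a + a') b = mult a b + mult a' b"
    and mult_add_right: "a \<in> A \<Longrightarrow> b \<in> A \<Longrightarrow> b' \<in> A \<Longrightarrow> mult a (b + b') = mult a b + mult a b'"
    and mult_scale_left: "a \<in> A \<Longrightarrow> b \<in> A \<Longrightarrow> mult (scale c a) b = scale c (mult a b)"
    and mult_scale_right: "a \<in> A \<Longrightarrow> b \<in> A \<Longrightarrow> mult a (scale c b) = scale c (mult a b)"
    and mult_assoc: "a \<in> A \<Longrightarrow> b \<in> A \<Longrightarrow> d \<in> A \<Longrightarrow> mult (mult a b) d = mult a (mult b d)"
    and mult_graded: "a \<in> G i \<Longrightarrow> b \<in> G j \<Longrightarrow> mult a b \<in> G (i + j)"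
    and one_in: "one \<in> G 0"
    and one_left: "a \<in> A \<Longrightarrow> mult one a = a"
    and one_right: "a \<in> A \<Longrightarrow> mult a one = a"

definition graded_subalgebra ::
    "('k::field \<Rightarrow> 'a::ab_group_add \<Rightarrow> 'a) \<Rightarrow> 'a set \<Rightarrow> (nat \<Rightarrow> 'a set) \<Rightarrow>
     'a set \<Rightarrow> (nat \<Rightarrow> 'a set) \<Rightarrow> ('a \<Rightarrow> 'a \<Rightarrow> 'a) \<Rightarrow> 'a \<Rightarrow> bool" where
  "graded_subalgebra scale B H A G mult one \<longleftrightarrow>
     B \<subseteq> A \<and> (\<forall>i. H i = B \<inter> G i) \<and>
     graded_algebra scale A G mult one \<and> graded_algebra scale B H mult one"

definition fun_scale :: "('k \<Rightarrow> 'b \<Rightarrow> 'b) \<Rightarrow> 'k \<Rightarrow> ('a \<Rightarrow> 'b) \<Rightarrow> 'a \<Rightarrow> 'b" where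
  "fun_scale scale c f = (\<lambda>x. scale c (f x))"

lemma vector_space_fun_scale:
  assumes "vector_space scale"
  shows "vector_space (fun_scale scale)"
proof -
  interpret vector_space scale by fact
  show ?thesis
    by unfold_locales (auto simp: fun_scale_def fun_eq_iff scale_right_distrib scale_left_distrib)
qed

text \<open>External direct sum of a sequence of subspaces, and its summands.\<close>

definition direct_sum :: "(nat \<Rightarrow> 'a::zero set) \<Rightarrow> (nat \<Rightarrow> 'a) set" where
  "direct_sum P = {w. (\<forall>j. w j \<in> P j) \<and> finite {j. w j \<noteq> 0}}"

definition homog :: "nat \<Rightarrow> 'a::zero \<Rightarrow> nat \<Rightarrow> 'a" where
  "homog i t = (\<lambda>j. if j = i then t else 0)"

text \<open>Tensor powers of a vector space \<open>V\<close> (the type \<open>'v\<close> with scalar multiplication \<open>scale\<close>).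
  The pure tensor of \<open>v\<^sub>1, \<dots>, v\<^sub>n\<close> is realised as evaluation of \<open>n\<close>-linear forms at
  \<open>(v\<^sub>1, \<dots>, v\<^sub>n)\<close>, and the \<open>n\<close>-th tensor power is the span of the pure tensors of length \<open>n\<close>.
  Over a field this is the tensor power for every \<open>V\<close>, of finite dimension or not:
  see \<open>tensor_power_universal\<close> below. In degree \<open>0\<close> it is the line spanned by the empty
  pure tensor, which is \<open>1\<close> under the identification with the ground field.\<close>

definition multilinear :: "('k::field \<Rightarrow> 'v::ab_group_add \<Rightarrow> 'v) \<Rightarrow>
    ('k \<Rightarrow> 'w::ab_group_add \<Rightarrow> 'w) \<Rightarrow> nat \<Rightarrow> ('v list \<Rightarrow> 'w) \<Rightarrow> bool" where
  "multilinear s1 s2 n F \<longleftrightarrow>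
     (\<forall>vs i. length vs = n \<longrightarrow> i < n \<longrightarrow> Vector_Spaces.linear s1 s2 (\<lambda>v. F (vs[i := v])))"

type_synonym ('k, 'v) tensor = "('v list \<Rightarrow> 'k) \<Rightarrow> 'k"

definition pure_tensor ::
    "('k::field \<Rightarrow> 'v::ab_group_add \<Rightarrow> 'v) \<Rightarrow> 'v list \<Rightarrow> ('k, 'v) tensor" where
  "pure_tensor scale vs = (\<lambda>F. if multilinear scale (*) (length vs) F then F vs else 0)"

abbreviation tensor_scale :: "'k::field \<Rightarrow> ('k, 'v) tensor \<Rightarrow> ('k, 'v) tensor" where
  "tensor_scale \<equiv> fun_scale (*)"

definition tensor_power ::
    "('k::field \<Rightarrow> 'v::ab_group_add \<Rightarrow> 'v) \<Rightarrow> nat \<Rightarrow> ('k, 'v) tensor set" where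
  "tensor_power scale n = module.span tensor_scale (pure_tensor scale ` {vs. length vs = n})"

lemma vector_space_mult: "vector_space ((*) :: 'k::field \<Rightarrow> 'k \<Rightarrow> 'k)"
  by unfold_locales (auto simp: algebra_simps)

interpretation tensor: vector_space "tensor_scale :: 'k::field \<Rightarrow> ('k, 'v) tensor \<Rightarrow> ('k, 'v) tensor"
  by (rule vector_space_fun_scale[OF vector_space_mult])

lemma multilinear_functional:
  assumes "multilinear s1 s2 n M" and "Vector_Spaces.linear s2 s3 g"
  shows "multilinear s1 s3 n (\<lambda>vs. g (M vs))"
  using assms Vector_Spaces.linear_compose[of s1 s2 _ s3 g]
  unfolding multilinear_def comp_def by blast

lemma linear_coordinate:
  "Vector_Spaces.linear tensor_scale (*) (\<lambda>t :: ('k::field, 'v) tensor. t F)"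
  by (simp add: Vector_Spaces.linear_iff vector_space_mult tensor.vector_space_axioms fun_scale_def)

lemma multilinear_pure_tensor:
  assumes "vector_space scale"
  shows "multilinear scale tensor_scale n (pure_tensor scale)"
proof -
  have "Vector_Spaces.linear scale tensor_scale (\<lambda>v. pure_tensor scale (vs[i := v]))"
    if "length vs = n" "i < n" for vs i
  proof -
    have lin: "Vector_Spaces.linear scale (*) (\<lambda>v. F (vs[i := v]))"
      if "multilinear scale (*) (length vs) F" for F
      using that \<open>length vs = n\<close> \<open>i < n\<close> by (auto simp: multilinear_def)
    have a: "pure_tensor scale (vs[i := v + w]) =
        pure_tensor scale (vs[i := v]) + pure_tensor scale (vs[i := w])" for v w
      using lin by (auto simp: pure_tensor_def fun_eq_iff Vector_Spaces.linear_iff)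
    have b: "pure_tensor scale (vs[i := scale c v]) =
        tensor_scale c (pure_tensor scale (vs[i := v]))" for c v
      using lin by (auto simp: pure_tensor_def fun_eq_iff Vector_Spaces.linear_iff fun_scale_def)
    show ?thesis
      using a b assms by (simp add: Vector_Spaces.linear_iff tensor.vector_space_axioms)
  qed
  then show ?thesis by (simp add: multilinear_def)
qed

lemma pure_tensor_in_power: "pure_tensor scale vs \<in> tensor_power scale (length vs)"
  by (auto simp: tensor_power_def intro: tensor.span_base)

lemma tensor_power_universal:
  fixes scale :: "'k::field \<Rightarrow> 'v::ab_group_add \<Rightarrow> 'v"
    and scaleW :: "'k \<Rightarrow> 'w::ab_group_add \<Rightarrow> 'w"
  assumes "vector_space scale" and W: "vector_space scaleW"
    and M: "multilinear scale scaleW n M"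
  shows "\<exists>g. Vector_Spaces.linear tensor_scale scaleW g \<and>
              (\<forall>vs. length vs = n \<longrightarrow> g (pure_tensor scale vs) = M vs)"
    and "Vector_Spaces.linear tensor_scale scaleW g \<Longrightarrow>
         Vector_Spaces.linear tensor_scale scaleW h \<Longrightarrow>
         (\<And>vs. length vs = n \<Longrightarrow> g (pure_tensor scale vs) = M vs) \<Longrightarrow>
         (\<And>vs. length vs = n \<Longrightarrow> h (pure_tensor scale vs) = M vs) \<Longrightarrow>
         t \<in> tensor_power scale n \<Longrightarrow> g t = h t"
proof -
  interpret W: vector_space scaleW by fact
  interpret TW: vector_space_pair "tensor_scale :: 'k \<Rightarrow> ('k, 'v) tensor \<Rightarrow> _" scaleW
    by unfold_locales
  interpret K: vector_space "(*) :: 'k \<Rightarrow> 'k \<Rightarrow> 'k" by (rule vector_space_mult)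
  interpret WK: vector_space_pair scaleW "(*) :: 'k \<Rightarrow> 'k \<Rightarrow> 'k" by unfold_locales
  interpret TK: vector_space_pair "tensor_scale :: 'k \<Rightarrow> ('k, 'v) tensor \<Rightarrow> _" "(*) :: 'k \<Rightarrow> 'k \<Rightarrow> 'k"
    by unfold_locales
  let ?P = "pure_tensor scale ` {vs. length vs = n}"
  show "g t = h t" if "Vector_Spaces.linear tensor_scale scaleW g"
    "Vector_Spaces.linear tensor_scale scaleW h"
    "\<And>vs. length vs = n \<Longrightarrow> g (pure_tensor scale vs) = M vs"
    "\<And>vs. length vs = n \<Longrightarrow> h (pure_tensor scale vs) = M vs"
    "t \<in> tensor_power scale n" for g h
    by (rule TW.linear_eq_on_span[OF that(1,2), of ?P])
      (use that(3-) in \<open>auto simp: tensor_power_def\<close>)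
  obtain B where B: "B \<subseteq> ?P" "tensor.independent B" "?P \<subseteq> tensor.span B"
    using tensor.maximal_independent_subset[of ?P] by blast
  have "\<forall>b\<in>B. \<exists>vs. length vs = n \<and> pure_tensor scale vs = b" using B(1) by auto
  then obtain r where r: "\<And>b. b \<in> B \<Longrightarrow> length (r b) = n \<and> pure_tensor scale (r b) = b"
    unfolding bchoice_iff by blast
  obtain g where g: "Vector_Spaces.linear tensor_scale scaleW g" "\<And>b. b \<in> B \<Longrightarrow> g b = M (r b)"
    using TW.linear_independent_extend[OF B(2), of "\<lambda>b. M (r b)"] by blast
  have "g (pure_tensor scale vs) = M vs" if vs: "length vs = n" for vs
  proof (rule ccontr)
    assume ne: "g (pure_tensor scale vs) \<noteq> M vs"
    define w where "w = g (pure_tensor scale vs) - M vs"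
    have "W.independent {w}" using ne by (simp add: w_def)
    from WK.linear_independent_extend[OF this, of "\<lambda>_. 1"]
    obtain l where l: "Vector_Spaces.linear scaleW (*) l" "l w = 1" by blast
    define F where "F = (\<lambda>vs. l (M vs))"
    have F: "multilinear scale (*) n F" unfolding F_def by (rule multilinear_functional[OF M l(1)])
    have lg: "Vector_Spaces.linear tensor_scale (*) (l \<circ> g)"
      by (rule Vector_Spaces.linear_compose[OF g(1) l(1)])
    have "(l \<circ> g) b = b F" if b: "b \<in> B" for b
    proof -
      have "b F = pure_tensor scale (r b) F" using r[OF b] by simp
      then show ?thesis using g(2)[OF b] r[OF b] F by (simp add: pure_tensor_def F_def)
    qed
    moreover have "pure_tensor scale vs \<in> tensor.span B" using B(3) vs by blast
    ultimately have "(l \<circ> g) (pure_tensor scale vs) = pure_tensor scale vs F"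
      using TK.linear_eq_on_span[OF lg linear_coordinate[of F], of B] by blast
    then have "l (g (pure_tensor scale vs)) = l (M vs)"
      using F vs by (simp add: pure_tensor_def F_def)
    moreover have "l w = l (g (pure_tensor scale vs)) - l (M vs)"
      unfolding w_def by (rule WK.linear_diff[OF l(1)])
    ultimately show False using l(2) by simp
  qed
  with g(1) show "\<exists>g. Vector_Spaces.linear tensor_scale scaleW g \<and>
              (\<forall>vs. length vs = n \<longrightarrow> g (pure_tensor scale vs) = M vs)" by blast
qed

text \<open>The linear map on tensor powers induced by a multilinear map \<open>M\<close> with values in tensors;
  see \<open>tensor_lift_pure\<close>.\<close>

definition tensor_lift ::
    "('v list \<Rightarrow> ('k, 'v) tensor) \<Rightarrow> ('k, 'v) tensor \<Rightarrow> ('k, 'v) tensor" where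
  "tensor_lift M t = (\<lambda>F. t (\<lambda>vs. M vs F))"

lemma tensor_lift_pure:
  assumes "multilinear scale tensor_scale (length vs) M"
  shows "tensor_lift M (pure_tensor scale vs) = M vs"
  using multilinear_functional[OF assms linear_coordinate]
  by (simp add: tensor_lift_def pure_tensor_def fun_eq_iff)

lemma tensor_lift_linear:
  "tensor_lift M 0 = 0" "tensor_lift M (t + u) = tensor_lift M t + tensor_lift M u"
  "tensor_lift M (tensor_scale c t) = tensor_scale c (tensor_lift M t)"
  by (auto simp: tensor_lift_def fun_scale_def fun_eq_iff)

definition tensor_prod :: "('k::field \<Rightarrow> 'v::ab_group_add \<Rightarrow> 'v) \<Rightarrow>
    ('k, 'v) tensor \<Rightarrow> ('k, 'v) tensor \<Rightarrow> ('k, 'v) tensor" where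
  "tensor_prod scale t u =
     tensor_lift (\<lambda>xs. tensor_lift (\<lambda>ys. pure_tensor scale (xs @ ys)) u) t"

definition is_endomorphism ::
    "('k \<Rightarrow> 'a::ab_group_add \<Rightarrow> 'a) \<Rightarrow> 'a set \<Rightarrow> ('a \<Rightarrow> 'a) \<Rightarrow> bool" where
  "is_endomorphism scale S f \<longleftrightarrow>
     (\<forall>x\<in>S. f x \<in> S) \<and> (\<forall>x\<in>S. \<forall>y\<in>S. f (x + y) = f x + f y) \<and>
     (\<forall>c. \<forall>x\<in>S. f (scale c x) = scale c (f x))"

text \<open>\<open>local_op scale f k\<close> is \<open>f\<close> acting in the tensor factors \<open>k\<close> and \<open>k + 1\<close> (counted from \<open>1\<close>),
  on all tensor powers of degree at least \<open>k + 1\<close> at once; see \<open>local_op_pure\<close>.\<close>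

definition local_op :: "('k::field \<Rightarrow> 'v::ab_group_add \<Rightarrow> 'v) \<Rightarrow>
    (('k, 'v) tensor \<Rightarrow> ('k, 'v) tensor) \<Rightarrow> nat \<Rightarrow> ('k, 'v) tensor \<Rightarrow> ('k, 'v) tensor" where
  "local_op scale f k = tensor_lift (\<lambda>vs.
     tensor_prod scale
       (tensor_prod scale (pure_tensor scale (take (k - 1) vs))
          (f (pure_tensor scale (take 2 (drop (k - 1) vs)))))
       (pure_tensor scale (drop (k + 1) vs)))"

lemma multilinear_combination:
  fixes M M' :: "'v::ab_group_add list \<Rightarrow> ('k::field, 'v) tensor"
  assumes "vector_space scale"
    and M: "multilinear scale tensor_scale n M" and M': "multilinear scale tensor_scale n M'"
  shows "multilinear scale tensor_scale n (\<lambda>vs. tensor_scale c (M vs) + M' vs)"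
  unfolding multilinear_def
proof (intro allI impI)
  interpret vector_space_pair scale "tensor_scale :: 'k \<Rightarrow> ('k, 'v) tensor \<Rightarrow> _"
    using assms(1) tensor.vector_space_axioms by (rule vector_space_pair.intro)
  fix vs :: "'v list" and i assume "length vs = n" "i < n"
  then show "Vector_Spaces.linear scale tensor_scale
      (\<lambda>v. tensor_scale c (M (vs[i := v])) + M' (vs[i := v]))"
    using M M' by (intro linear_compose_add linear_compose_scale_right) (simp_all add: multilinear_def)
qed

lemma tensor_prod_left_linear:
  "tensor_prod scale 0 u = 0"
  "tensor_prod scale (t + t') u = tensor_prod scale t u + tensor_prod scale t' u"
  "tensor_prod scale (tensor_scale c t) u = tensor_scale c (tensor_prod scale t u)"
  by (simp_all add: tensor_prod_def tensor_lift_linear)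

lemma multilinear_append:
  fixes scale :: "'k::field \<Rightarrow> 'v::ab_group_add \<Rightarrow> 'v"
  assumes "vector_space scale"
  shows "multilinear scale tensor_scale n (\<lambda>ys. pure_tensor scale (xs @ ys))"
    and "multilinear scale tensor_scale n (\<lambda>xs. pure_tensor scale (xs @ ys))"
proof -
  have *: "\<And>vs i. i < length vs \<Longrightarrow>
      Vector_Spaces.linear scale tensor_scale (\<lambda>v. pure_tensor scale (vs[i := v]))"
    using multilinear_pure_tensor[OF assms] by (auto simp: multilinear_def)
  show "multilinear scale tensor_scale n (\<lambda>ys. pure_tensor scale (xs @ ys))"
    unfolding multilinear_def
  proof (intro allI impI)
    fix vs :: "'v list" and i assume "length vs = n" "i < n"
    then show "Vector_Spaces.linear scale tensor_scale (\<lambda>v. pure_tensor scale (xs @ vs[i := v]))"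
      using *[of "length xs + i" "xs @ vs"] by (simp add: list_update_append)
  qed
  show "multilinear scale tensor_scale n (\<lambda>xs. pure_tensor scale (xs @ ys))"
    unfolding multilinear_def
  proof (intro allI impI)
    fix vs :: "'v list" and i assume "length vs = n" "i < n"
    then show "Vector_Spaces.linear scale tensor_scale (\<lambda>v. pure_tensor scale (vs[i := v] @ ys))"
      using *[of i "vs @ ys"] by (simp add: list_update_append)
  qed
qed

lemma multilinear_zero:
  "vector_space scale \<Longrightarrow> multilinear scale tensor_scale n (\<lambda>_. 0 :: ('k::field, 'v) tensor)"
  by (auto simp: multilinear_def Vector_Spaces.linear_iff tensor.vector_space_axioms fun_scale_def fun_eq_iff)

lemma tensor_power_induct [consumes 1, case_names zero step]:
  assumes "t \<in> tensor_power scale n" "P 0"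
    "\<And>c vs t. length vs = n \<Longrightarrow> t \<in> tensor_power scale n \<Longrightarrow> P t \<Longrightarrow>
       P (tensor_scale c (pure_tensor scale vs) + t)"
  shows "P t"
proof -
  have "t \<in> tensor_power scale n \<and> P t"
    using assms(1)[unfolded tensor_power_def]
  proof (induct rule: tensor.span_induct_alt)
    case base
    then show ?case using assms(2) by (simp add: tensor_power_def tensor.span_zero del: zero_fun_apply)
  next
    case (step c x y)
    then obtain vs where vs: "length vs = n" "x = pure_tensor scale vs" by auto
    have "tensor_scale c x + y \<in> tensor_power scale n"
      using step vs pure_tensor_in_power[of scale vs]
      by (simp add: tensor_power_def tensor.span_add tensor.span_scale)
    then show ?case using step vs assms(3) by blast
  qed
  then show ?thesis ..
qed

lemma multilinear_lift_append:
  assumes V: "vector_space scale" and u: "u \<in> tensor_power scale m"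
  shows "multilinear scale tensor_scale n
           (\<lambda>xs. tensor_lift (\<lambda>ys. pure_tensor scale (xs @ ys)) u)"
  using u
proof (induction rule: tensor_power_induct)
  case zero
  then show ?case by (simp add: tensor_lift_linear multilinear_zero[OF V] del: zero_fun_apply)
next
  case (step c vs t)
  then show ?case
    using multilinear_combination[OF V multilinear_append(2)[OF V] step(3)]
    by (simp add: tensor_lift_linear tensor_lift_pure multilinear_append[OF V] del: plus_fun_apply)
qed

lemma tensor_prod_pure_left:
  assumes "vector_space scale" "u \<in> tensor_power scale m"
  shows "tensor_prod scale (pure_tensor scale xs) u =
         tensor_lift (\<lambda>ys. pure_tensor scale (xs @ ys)) u"
  unfolding tensor_prod_def by (rule tensor_lift_pure[OF multilinear_lift_append[OF assms]])

lemma tensor_prod_pure: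
  assumes "vector_space scale"
  shows "tensor_prod scale (pure_tensor scale xs) (pure_tensor scale ys) =
         pure_tensor scale (xs @ ys)"
  using tensor_prod_pure_left[OF assms pure_tensor_in_power]
    tensor_lift_pure[OF multilinear_append(1)[OF assms]] by simp

lemma tensor_prod_pure_closed:
  assumes V: "vector_space scale" and u: "u \<in> tensor_power scale m"
  shows "tensor_prod scale (pure_tensor scale xs) u \<in> tensor_power scale (length xs + m)"
  unfolding tensor_prod_pure_left[OF assms] using u
proof (induction rule: tensor_power_induct)
  case zero
  then show ?case by (simp add: tensor_lift_linear tensor_power_def tensor.span_zero del: zero_fun_apply)
next
  case (step c vs t)
  then show ?case
    using pure_tensor_in_power[of scale "xs @ vs"]
    by (simp add: tensor_lift_linear tensor_lift_pure multilinear_append[OF V]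
        tensor_power_def tensor.span_add tensor.span_scale del: plus_fun_apply)
qed

lemma multilinear_prod_right:
  assumes V: "vector_space scale" and t: "t \<in> tensor_power scale m"
  shows "multilinear scale tensor_scale n (\<lambda>ys. tensor_prod scale t (pure_tensor scale ys))"
  using t
proof (induction rule: tensor_power_induct)
  case zero
  then show ?case by (simp add: tensor_prod_left_linear multilinear_zero[OF V] del: zero_fun_apply)
next
  case (step c vs t)
  then show ?case
    using multilinear_combination[OF V multilinear_append(1)[OF V] step(3)]
    by (simp add: tensor_prod_left_linear tensor_prod_pure[OF V] del: plus_fun_apply)
qed

lemma local_op_pure:
  assumes V: "vector_space scale"
    and f: "is_endomorphism tensor_scale (tensor_power scale 2) f"
    and k: "1 \<le> k" "k + 1 \<le> length vs"
  shows "local_op scale f k (pure_tensor scale vs) =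
     tensor_prod scale
       (tensor_prod scale (pure_tensor scale (take (k - 1) vs))
          (f (pure_tensor scale [vs ! (k - 1), vs ! k])))
       (pure_tensor scale (drop (k + 1) vs))"
proof -
  let ?T = "\<lambda>vs. pure_tensor scale (take (k - 1) vs)"
  let ?m = "\<lambda>vs. pure_tensor scale (take 2 (drop (k - 1) vs))"
  let ?D = "\<lambda>vs. pure_tensor scale (drop (k + 1) vs)"
  have lin: "\<And>vs i. i < length vs \<Longrightarrow>
      Vector_Spaces.linear scale tensor_scale (\<lambda>v. pure_tensor scale (vs[i := v]))"
    using multilinear_pure_tensor[OF V] by (auto simp: multilinear_def)
  have "Vector_Spaces.linear scale tensor_scale (\<lambda>v.
      tensor_prod scale (tensor_prod scale (?T (us[i := v])) (f (?m (us[i := v])))) (?D (us[i := v])))"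
    if us: "length us = length vs" "i < length vs" for us i
  proof -
    have m2: "length (take 2 (drop (k - 1) us)) = 2" using us k by simp
    have mp: "pure_tensor scale ws \<in> tensor_power scale 2" if "length ws = 2" for ws
      using pure_tensor_in_power[of scale ws] that by simp
    have fp: "f (pure_tensor scale ws) \<in> tensor_power scale 2" if "length ws = 2" for ws
      using mp[OF that] f by (simp add: is_endomorphism_def)
    consider "i < k - 1" | "k - 1 \<le> i" "i < k + 1" | "k + 1 \<le> i" by linarith
    then show ?thesis
    proof cases
      case 1
      then have e: "take (k - 1) (us[i := v]) = (take (k - 1) us)[i := v]"
        "take 2 (drop (k - 1) (us[i := v])) = take 2 (drop (k - 1) us)"
        "drop (k + 1) (us[i := v]) = drop (k + 1) us" for v
        by (simp_all add: take_update_swap drop_update_cancel)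
      show ?thesis unfolding e
        using lin[of i "take (k - 1) us"] 1 us k
        by (simp add: Vector_Spaces.linear_iff tensor_prod_left_linear)
    next
      case 2
      let ?q = "take 2 (drop (k - 1) us)" and ?j = "i - (k - 1)"
      from 2 have e: "take (k - 1) (us[i := v]) = take (k - 1) us"
        "take 2 (drop (k - 1) (us[i := v])) = ?q[?j := v]"
        "drop (k + 1) (us[i := v]) = drop (k + 1) us" for v
        by (simp_all add: drop_update_swap take_update_swap[of 2])
      have j: "?j < length ?q" using 2 m2 k by linarith
      have "Vector_Spaces.linear scale tensor_scale (\<lambda>v. f (pure_tensor scale (?q[?j := v])))"
        using lin[OF j] f mp[of "?q[?j := _]"] m2
        by (simp add: Vector_Spaces.linear_iff is_endomorphism_def)
      then show ?thesis unfolding e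
        using fp[of "?q[?j := _]"] m2
        by (simp add: Vector_Spaces.linear_iff tensor_prod_left_linear tensor_prod_pure_left[OF V fp]
            tensor_lift_linear)
    next
      case 3
      then have e: "take (k - 1) (us[i := v]) = take (k - 1) us"
        "take 2 (drop (k - 1) (us[i := v])) = take 2 (drop (k - 1) us)"
        "drop (k + 1) (us[i := v]) = (drop (k + 1) us)[i - (k + 1) := v]" for v
        using k by (simp_all add: drop_update_swap)
      have "tensor_prod scale (?T us) (f (?m us)) \<in> tensor_power scale (length (take (k - 1) us) + 2)"
        by (rule tensor_prod_pure_closed[OF V fp[OF m2]])
      from multilinear_prod_right[OF V this, of "length (drop (k + 1) us)"] show ?thesis
        unfolding e using 3 us by (simp add: multilinear_def)
    qed
  qed
  then have "multilinear scale tensor_scale (length vs)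
      (\<lambda>vs. tensor_prod scale (tensor_prod scale (?T vs) (f (?m vs))) (?D vs))"
    by (simp add: multilinear_def)
  from tensor_lift_pure[OF this]
  have "local_op scale f k (pure_tensor scale vs) =
      tensor_prod scale (tensor_prod scale (?T vs) (f (?m vs))) (?D vs)"
    by (simp add: local_op_def)
  moreover have "take 2 (drop (k - 1) vs) = [vs ! (k - 1), vs ! k]"
    using k by (simp add: numeral_2_eq_2 take_Suc_conv_app_nth)
  ultimately show ?thesis by simp
qed

text \<open>The product of \<open>u\<close> in degree \<open>m\<close> and \<open>v\<close> in degree \<open>n\<close>, and its bilinear extension to
  the direct sum.\<close>

definition bshuffle_homog :: "('k::field \<Rightarrow> 'v::ab_group_add \<Rightarrow> 'v) \<Rightarrow>
    ('k \<Rightarrow> ('k, 'v) tensor \<Rightarrow> ('k, 'v) tensor) \<Rightarrow> 'k \<Rightarrow> nat \<Rightarrow> nat \<Rightarrow>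
    ('k, 'v) tensor \<Rightarrow> ('k, 'v) tensor \<Rightarrow> ('k, 'v) tensor" where
  "bshuffle_homog scale \<sigma> s m n u v =
     word_op (\<lambda>k x. local_op scale (\<sigma> x) k) (shuffle_word s n m) (tensor_prod scale u v)"

definition bshuffle :: "('k::field \<Rightarrow> 'v::ab_group_add \<Rightarrow> 'v) \<Rightarrow>
    ('k \<Rightarrow> ('k, 'v) tensor \<Rightarrow> ('k, 'v) tensor) \<Rightarrow> 'k \<Rightarrow>
    (nat \<Rightarrow> ('k, 'v) tensor) \<Rightarrow> (nat \<Rightarrow> ('k, 'v) tensor) \<Rightarrow> nat \<Rightarrow> ('k, 'v) tensor" where
  "bshuffle scale \<sigma> s u v =
     (\<lambda>N. \<Sum>m\<le>N. bshuffle_homog scale \<sigma> s m (N - m) (u m) (v (N - m)))"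

definition Sigma_image :: "('k::field \<Rightarrow> 'v::ab_group_add \<Rightarrow> 'v) \<Rightarrow>
    ('k \<Rightarrow> ('k, 'v) tensor \<Rightarrow> ('k, 'v) tensor) \<Rightarrow> 'k \<Rightarrow> nat \<Rightarrow> ('k, 'v) tensor set" where
  "Sigma_image scale \<sigma> s j =
     word_op (\<lambda>k x. local_op scale (\<sigma> x) k) (Sigma_word s j) ` tensor_power scale j"

end

theory Submission
  imports Defs
begin

text \<open>Read a word in the letters \<open>\<sigma>\<^sub>k(x)\<close> as a braid whose crossings carry spectral parameters. A
  shuffle word is then a bundle of strands crossing another bundle, and the shuffle identity compares
  two ways of crossing three bundles \<open>M\<close>, \<open>N\<close>, \<open>K\<close>. Moving a single strand of \<open>K\<close> past a single
  strand of \<open>N\<close> across the bundle \<open>M\<close> needs one Yang-Baxter move for each strand of \<open>M\<close>; induction on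
  the sizes of \<open>N\<close> and of \<open>K\<close> then gives the identity already for words, modulo Yang-Baxter moves and
  commutation of distant letters.

  In a local representation the shuffle identity is associativity of the product. Since
  \<open>\<Sigma>\<^bsub>m+1\<^esub> = Sh\<^bsub>1,m\<^esub> \<Sigma>\<^bsub>m\<^esub>\<close>, it also gives \<open>\<Sigma>\<^bsub>m+n\<^esub> = Sh\<^bsub>n,m\<^esub> (\<Sigma>\<^bsub>m\<^esub> \<otimes> \<Sigma>\<^bsub>n\<^esub>)\<close> by induction on \<open>n\<close>,
  which is closure of the images under the product.\<close>

section \<open>Words modulo Yang-Baxter moves\<close>

text \<open>There is no symmetry rule: all derivations below use the Yang-Baxter equation from right to left
  only.\<close>

inductive yb_equiv :: "'k::monoid_mult set \<Rightarrow> (nat \<times> 'k) list \<Rightarrow> (nat \<times> 'k) list \<Rightarrow> bool"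
  for X where
  refl [simp, intro]: "yb_equiv X w w"
| trans [trans]: "yb_equiv X u v \<Longrightarrow> yb_equiv X v w \<Longrightarrow> yb_equiv X u w"
| append: "yb_equiv X v v' \<Longrightarrow> yb_equiv X w w' \<Longrightarrow> yb_equiv X (v @ w) (v' @ w')"
| yang_baxter: "1 \<le> k \<Longrightarrow> x \<in> X \<Longrightarrow> y \<in> X \<Longrightarrow> x * y \<in> X \<Longrightarrow>
    yb_equiv X [(k, y), (k + 1, x * y), (k, x)] [(k + 1, x), (k, x * y), (k + 1, y)]"
| far_commute: "1 \<le> k \<Longrightarrow> 1 \<le> l \<Longrightarrow> x \<in> X \<Longrightarrow> y \<in> X \<Longrightarrow> \<bar>int k - int l\<bar> > 1 \<Longrightarrow>
    yb_equiv X [(k, x), (l, y)] [(l, y), (k, x)]"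

lemma yb_equiv_append_left: "yb_equiv X v v' \<Longrightarrow> yb_equiv X (u @ v) (u @ v')"
  and yb_equiv_append_right: "yb_equiv X v v' \<Longrightarrow> yb_equiv X (v @ w) (v' @ w)"
  by (intro yb_equiv.append yb_equiv.refl; assumption)+

lemma yb_equiv_context: "yb_equiv X v v' \<Longrightarrow> yb_equiv X (u @ v @ w) (u @ v' @ w)"
  by (intro yb_equiv_append_left yb_equiv_append_right)

lemma shift_word_append [simp]: "shift_word l (v @ w) = shift_word l v @ shift_word l w"
  by (simp add: shift_word_def)

lemma shift_word_Nil [simp]: "shift_word l [] = []"
  by (simp add: shift_word_def)

lemma shift_word_shift_word [simp]: "shift_word l (shift_word m w) = shift_word (m + l) w"
  by (simp add: shift_word_def split_beta add.assoc)

text \<open>Both moves survive raising all indices. This is needed because the inductions below peel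
  off one strand, so their hypotheses reappear shifted by one.\<close>

lemma yb_equiv_shift: "yb_equiv X v w \<Longrightarrow> yb_equiv X (shift_word l v) (shift_word l w)"
proof (induction rule: yb_equiv.induct)
  case (trans u v w)
  then show ?case by (blast intro: yb_equiv.trans)
next
  case (append v v' w w')
  then show ?case by (simp add: yb_equiv.append)
next
  case (yang_baxter k x y)
  then show ?case using yb_equiv.yang_baxter[of "k + l" x X y] by (simp add: shift_word_def)
next
  case (far_commute k k' x y)
  then show ?case using yb_equiv.far_commute[of "k + l" "k' + l" x X y] by (simp add: shift_word_def)
qed simp

lemma yb_equiv_letter_commute:
  assumes "1 \<le> k" "x \<in> X" "\<And>l y. (l, y) \<in> set w \<Longrightarrow> 1 \<le> l \<and> y \<in> X \<and> \<bar>int k - int l\<bar> > 1"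
  shows "yb_equiv X ((k, x) # w) (w @ [(k, x)])"
  using assms(3)
proof (induction w)
  case (Cons a w)
  obtain l y where a: "a = (l, y)" by (cases a)
  have "yb_equiv X ([(k, x), (l, y)] @ w) ([(l, y), (k, x)] @ w)"
    using Cons.prems assms(1,2) by (intro yb_equiv.append yb_equiv.far_commute) (auto simp: a)
  moreover have "yb_equiv X ([(l, y)] @ (k, x) # w) ([(l, y)] @ w @ [(k, x)])"
    using Cons.prems by (intro yb_equiv_append_left Cons.IH) (meson list.set_intros(2))
  ultimately show ?case by (simp add: a) (rule yb_equiv.trans)
qed simp

lemma yb_equiv_commute:
  assumes "\<And>k x l y. (k, x) \<in> set v \<Longrightarrow> (l, y) \<in> set w \<Longrightarrow> \<bar>int k - int l\<bar> > 1"
    and "\<And>k x. (k, x) \<in> set v \<Longrightarrow> 1 \<le> k \<and> x \<in> X"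
    and "\<And>l y. (l, y) \<in> set w \<Longrightarrow> 1 \<le> l \<and> y \<in> X"
  shows "yb_equiv X (v @ w) (w @ v)"
  using assms(1,2)
proof (induction v)
  case (Cons a v)
  obtain k x where a: "a = (k, x)" by (cases a)
  have "yb_equiv X (v @ w) (w @ v)"
    using Cons.prems by (intro Cons.IH) (meson list.set_intros(2))+
  then have "yb_equiv X ([a] @ v @ w) ([a] @ w @ v)"
    by (rule yb_equiv_append_left)
  moreover have "yb_equiv X ((k, x) # w) (w @ [(k, x)])"
    using Cons.prems(1)[of k x] Cons.prems(2)[of k x] assms(3)
    by (intro yb_equiv_letter_commute) (auto simp: a)
  then have "yb_equiv X (((k, x) # w) @ v) ((w @ [(k, x)]) @ v)"
    by (rule yb_equiv_append_right)
  ultimately show ?case by (simp add: a) (rule yb_equiv.trans)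
qed simp

section \<open>The shuffle identity for words\<close>

text \<open>One strand crossing a bundle of \<open>n\<close> strands. The brackets of the shuffle
  are runs with coupled start index and start exponent; the two are separate here because shifting
  changes only the index.\<close>

definition run :: "'k::monoid_mult \<Rightarrow> nat \<Rightarrow> nat \<Rightarrow> nat \<Rightarrow> (nat \<times> 'k) list" where
  "run s a p n = map (\<lambda>j. (a + j, s ^ (p + j))) [0..<n]"

lemma run_0 [simp]: "run s a p 0 = []"
  by (simp add: run_def)

lemma run_add: "run s a p (m + n) = run s a p m @ run s (a + m) (p + m) n"
proof -
  have "map (\<lambda>j. (a + j, s ^ (p + j))) [m..<m + n] = run s (a + m) (p + m) n"
    by (rule nth_equalityI) (auto simp: run_def add.assoc)
  then show ?thesis
    using upt_add_eq_append[of 0 m n] by (simp add: run_def)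
qed

lemma run_Suc: "run s a p (Suc n) = (a, s ^ p) # run s (Suc a) (Suc p) n"
  using run_add[of s a p 1 n] by (simp add: run_def)

lemma shift_word_run [simp]: "shift_word l (run s a p n) = run s (a + l) p n"
  by (simp add: run_def shift_word_def)

lemma shuffle_word_0 [simp]: "shuffle_word s 0 n = []" "shuffle_word s m 0 = []"
  by (simp_all add: shuffle_word_def)

text \<open>Raising \<open>m\<close> raises the index \<open>m + j - i\<close> of every old letter
  by one and leaves its exponent \<open>i + j - 1\<close> alone. The new bracket is the last one and
  starts at index 1.\<close>

lemma shuffle_word_Suc:
  "shuffle_word s (Suc m) n = shift_word 1 (shuffle_word s m n) @ run s 1 (Suc m) n"
proof -
  have "map (\<lambda>j. (Suc m + j - Suc m, s ^ (Suc m + j - 1))) [1..<Suc n] = run s 1 (Suc m) n"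
    by (rule nth_equalityI) (auto simp: run_def simp del: upt_Suc)
  moreover have "shift_word 1 (shuffle_word s m n) =
      concat (map (\<lambda>i. map (\<lambda>j. (Suc m + j - i, s ^ (i + j - 1))) [1..<Suc n]) [1..<Suc m])"
    by (auto simp: shuffle_word_def shift_word_def map_concat comp_def simp del: upt_Suc
        intro!: arg_cong[where f = concat] map_cong)
  ultimately show ?thesis
    by (simp add: shuffle_word_def)
qed

lemma shuffle_word_1: "shuffle_word s 1 n = run s 1 1 n"
  using shuffle_word_Suc[of s 0 n] by simp

lemma Sigma_word_0: "Sigma_word s 0 = []"
  by (simp add: Sigma_word_def)

lemma Sigma_word_Suc: "Sigma_word s (Suc m) = shuffle_word s 1 m @ Sigma_word s m"
\<comment> \<open>The brackets are listed for \<open>r\<close> from 2 on, so for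
  \<open>m = 0\<close> there is none to split off and both sides are empty.\<close>
proof (cases m)
  case (Suc n)
  have "map (\<lambda>j. (j, s ^ j)) [1..<Suc m] = run s 1 1 m"
    by (rule nth_equalityI) (auto simp: run_def simp del: upt_Suc)
  then show ?thesis
    using Suc by (simp add: Sigma_word_def shuffle_word_1 del: One_nat_def)
qed (simp add: Sigma_word_def)

section \<open>Index ranges and commutation of separated words\<close>

text \<open>The half-open index range decides which words commute. Exponents are at least 1 because
  \<open>X\<close> is only known to contain the powers \<open>s ^ j\<close> with
  \<open>j \<ge> 1\<close>.\<close>

definition power_word :: "'k::monoid_mult \<Rightarrow> nat \<Rightarrow> nat \<Rightarrow> (nat \<times> 'k) list \<Rightarrow> bool" where
  "power_word s a b w \<longleftrightarrow> (\<forall>(k, x)\<in>set w. a \<le> k \<and> k < b \<and> (\<exists>j\<ge>1. x = s ^ j))"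

lemma power_word_Cons: "1 \<le> p \<Longrightarrow> power_word s a (Suc a) [(a, s ^ p)]"
  by (auto simp: power_word_def)

lemma power_word_run: "1 \<le> p \<Longrightarrow> power_word s a (a + n) (run s a p n)"
  by (auto simp: power_word_def run_def intro!: exI[of _ "p + _"])

lemma power_word_shuffle: "power_word s 1 (m + n) (shuffle_word s m n)"
proof -
  have "\<exists>l\<ge>1. s ^ (i + j - 1) = s ^ l" if "1 \<le> i" "1 \<le> j" for i j
    using that by (intro exI[of _ "i + j - 1"]) simp
  then show ?thesis
    by (auto simp: power_word_def shuffle_word_def simp del: upt_Suc)
qed

lemma power_word_Sigma: "power_word s 1 m (Sigma_word s m)"
  by (auto simp: power_word_def Sigma_word_def)

lemma power_word_shift: "power_word s a b w \<Longrightarrow> power_word s (a + l) (b + l) (shift_word l w)"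
  by (auto simp: power_word_def shift_word_def)

context
  fixes X :: "'k::comm_monoid_mult set" and s :: 'k
  assumes powers: "\<forall>j\<ge>1. s ^ j \<in> X"
begin

text \<open>The ranges are half-open, so \<open>k < b < c \<le> l\<close> puts the indices at
  distance at least 2. Both directions are recorded because \<open>yb_equiv\<close> has no symmetry
  rule.\<close>

lemma power_word_commute:
  assumes "power_word s a b v" "power_word s c d w" "1 \<le> a" "b < c"
  shows "yb_equiv X (v @ w) (w @ v)" "yb_equiv X (w @ v) (v @ w)"
proof -
  have v: "1 \<le> k \<and> k < b \<and> x \<in> X" if "(k, x) \<in> set v" for k x
    using assms(1,3) powers that by (auto simp: power_word_def)
  have w: "b < l \<and> 1 \<le> l \<and> y \<in> X" if "(l, y) \<in> set w" for l y
    using assms(2,4) powers that by (fastforce simp: power_word_def)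
  have far: "\<bar>int k - int l\<bar> > 1" "\<bar>int l - int k\<bar> > 1"
    if "(k, x) \<in> set v" "(l, y) \<in> set w" for k x l y
    using v[OF that(1)] w[OF that(2)] by linarith+
  show "yb_equiv X (v @ w) (w @ v)"
    by (rule yb_equiv_commute) (use v w far(1) in blast)+
  show "yb_equiv X (w @ v) (v @ w)"
    by (rule yb_equiv_commute) (use v w far(2) in blast)+
qed

text \<open>The strands \<open>a\<close> and \<open>a + 1\<close>, crossing each other with parameter \<open>s ^ c\<close>, are moved across a
  bundle of \<open>m\<close> strands.\<close>

lemma run_pair_exchange:
  assumes "1 \<le> a" "1 \<le> c" "1 \<le> p"
  shows "yb_equiv X ([(a, s ^ c)] @ run s (a + 1) (c + p) m @ run s a p m)
    (run s (a + 1) p m @ run s a (c + p) m @ [(a + m, s ^ c)])"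
  using assms
proof (induction m arbitrary: a p)
  case (Suc m)
  let ?R1 = "run s (a + 2) (c + p + 1) m" and ?R2 = "run s (a + 1) (p + 1) m"
  \<comment> \<open>The head of the second run has index \<open>a\<close>, the tail of the first run
    starts at \<open>a + 2\<close>; they commute, which brings three letters with indices
    \<open>a\<close>, \<open>a + 1\<close>, \<open>a\<close> together.\<close>
  have *: "yb_equiv X (?R1 @ [(a, s ^ p)]) ([(a, s ^ p)] @ ?R1)"
    by (rule power_word_commute(2)[OF power_word_Cons power_word_run]) (use Suc.prems in auto)
  have 1: "yb_equiv X ([(a, s ^ c), (a + 1, s ^ (c + p))] @ (?R1 @ [(a, s ^ p)]) @ ?R2)
      ([(a, s ^ c), (a + 1, s ^ (c + p))] @ ([(a, s ^ p)] @ ?R1) @ ?R2)"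
    by (rule yb_equiv_context[OF *])
  \<comment> \<open>Yang-Baxter with \<open>x = s ^ p\<close> and \<open>y = s ^ c\<close>: the
    crossing with exponent \<open>c\<close> moves up to index \<open>a + 1\<close>.\<close>
  have 2: "yb_equiv X ([(a, s ^ c), (a + 1, s ^ (c + p)), (a, s ^ p)] @ (?R1 @ ?R2))
      ([(a + 1, s ^ p), (a, s ^ (c + p)), (a + 1, s ^ c)] @ (?R1 @ ?R2))"
    using yb_equiv.yang_baxter[of a "s ^ p" X "s ^ c"] Suc.prems powers
    by (intro yb_equiv_append_right) (simp add: power_add[symmetric] add.commute)
  \<comment> \<open>There it meets the two tails, whose indices and exponents start one higher;
    hence \<open>a\<close> and \<open>p\<close> are arbitrary in the induction.\<close>
  have 3: "yb_equiv X ([(a + 1, s ^ p), (a, s ^ (c + p))] @ ([(a + 1, s ^ c)] @ ?R1 @ ?R2))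
      ([(a + 1, s ^ p), (a, s ^ (c + p))] @
        (run s (a + 2) (p + 1) m @ run s (a + 1) (c + p + 1) m @ [(a + 1 + m, s ^ c)]))"
    using Suc.IH[of "a + 1" "p + 1"] Suc.prems by (intro yb_equiv_append_left) simp
  \<comment> \<open>The new letter at index \<open>a\<close> passes the first tail and becomes the
    head of the second run.\<close>
  have *: "yb_equiv X ([(a, s ^ (c + p))] @ run s (a + 2) (p + 1) m)
      (run s (a + 2) (p + 1) m @ [(a, s ^ (c + p))])"
    by (rule power_word_commute(1)[OF power_word_Cons power_word_run]) (use Suc.prems in auto)
  have 4: "yb_equiv X ([(a + 1, s ^ p)] @ ([(a, s ^ (c + p))] @ run s (a + 2) (p + 1) m) @
        (run s (a + 1) (c + p + 1) m @ [(a + 1 + m, s ^ c)]))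
      ([(a + 1, s ^ p)] @ (run s (a + 2) (p + 1) m @ [(a, s ^ (c + p))]) @
        (run s (a + 1) (c + p + 1) m @ [(a + 1 + m, s ^ c)]))"
    by (rule yb_equiv_context[OF *])
  show ?case
    using 1 2 3 4 by (simp add: run_Suc) (meson yb_equiv.trans)
qed simp

text \<open>One strand of \<open>K\<close> crosses \<open>M\<close> and \<open>N\<close> together
  before, and each of them separately after, being moved past the crossing of \<open>N\<close> with
  \<open>M\<close>. The induction adds strands of \<open>N\<close>; the start exponent
  \<open>c\<close> is arbitrary since the hypothesis is used at \<open>c + 1\<close>.\<close>

lemma run_shuffle_exchange:
  assumes "1 \<le> c"
  shows "yb_equiv X (run s 1 c (m + n) @ shuffle_word s n m)
    (shift_word 1 (shuffle_word s n m) @ run s 1 (c + n) m @ run s (m + 1) c n)"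
  using assms
proof (induction n arbitrary: c)
  case (Suc n)
  let ?S = "shuffle_word s n m"
  \<comment> \<open>Without its first letter the long run is a shift by 1, and so is the shuffle
    without its last bracket: the hypothesis applies to the shifted middle.\<close>
  have 1: "yb_equiv X ([(1, s ^ c)] @ shift_word 1 (run s 1 (c + 1) (m + n) @ ?S) @ run s 1 (n + 1) m)
      ([(1, s ^ c)] @ shift_word 1 (shift_word 1 ?S @ run s 1 (c + 1 + n) m @ run s (m + 1) (c + 1) n)
        @ run s 1 (n + 1) m)"
    by (rule yb_equiv_context[OF yb_equiv_shift[OF Suc.IH]]) simp
  have *: "yb_equiv X ([(1, s ^ c)] @ shift_word 2 ?S) (shift_word 2 ?S @ [(1, s ^ c)])"
    by (rule power_word_commute(1)[OF power_word_Cons power_word_shift[OF power_word_shuffle]])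
      (use Suc.prems in auto)
  have **: "yb_equiv X (run s (m + 2) (c + 1) n @ run s 1 (n + 1) m)
      (run s 1 (n + 1) m @ run s (m + 2) (c + 1) n)"
    by (rule power_word_commute(2)[OF power_word_run power_word_run]) auto
  have 2: "yb_equiv X (([(1, s ^ c)] @ shift_word 2 ?S) @
        (run s 2 (c + (n + 1)) m @ (run s (m + 2) (c + 1) n @ run s 1 (n + 1) m)))
      ((shift_word 2 ?S @ [(1, s ^ c)]) @
        (run s 2 (c + (n + 1)) m @ (run s 1 (n + 1) m @ run s (m + 2) (c + 1) n)))"
    by (rule yb_equiv.append[OF * yb_equiv_append_left[OF **]])
  \<comment> \<open>The detached letter now stands before the runs of two strands over
    \<open>M\<close>, so \<open>run_pair_exchange\<close> applies with \<open>a = 1\<close>. The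
    letter comes out at index \<open>m + 1\<close> as the head of the run over
    \<open>N\<close>.\<close>
  have 3: "yb_equiv X (shift_word 2 ?S @
        ([(1, s ^ c)] @ run s (1 + 1) (c + (n + 1)) m @ run s 1 (n + 1) m) @ run s (m + 2) (c + 1) n)
      (shift_word 2 ?S @ (run s (1 + 1) (n + 1) m @ run s 1 (c + (n + 1)) m @ [(1 + m, s ^ c)]) @
        run s (m + 2) (c + 1) n)"
    by (rule yb_equiv_context[OF run_pair_exchange]) (use Suc.prems in auto)
  show ?case
    using 1 2 3 by (simp add: run_Suc shuffle_word_Suc numeral_2_eq_2) (meson yb_equiv.trans)
qed simp

text \<open>Each step adds a strand to \<open>K\<close>: the last bracket of
  \<open>shuffle_word s (Suc k) (m + n)\<close> is its run, carried past
  \<open>shuffle_word s n m\<close> by \<open>run_shuffle_exchange\<close>. What is left in front is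
  the shifted induction hypothesis.\<close>

lemma shuffle_word_equiv:
  "yb_equiv X (shuffle_word s k (m + n) @ shuffle_word s n m)
    (shuffle_word s (n + k) m @ shift_word m (shuffle_word s k n))"
proof (induction k)
  case (Suc k)
  let ?S = "shuffle_word s"
  have 1: "yb_equiv X (shift_word 1 (?S k (m + n)) @ (run s 1 (k + 1) (m + n) @ ?S n m))
      (shift_word 1 (?S k (m + n)) @
        (shift_word 1 (?S n m) @ run s 1 (k + 1 + n) m @ run s (m + 1) (k + 1) n))"
    by (rule yb_equiv_append_left[OF run_shuffle_exchange]) simp
  have 2: "yb_equiv X (shift_word 1 (?S k (m + n) @ ?S n m) @
        (run s 1 (k + 1 + n) m @ run s (m + 1) (k + 1) n))
      (shift_word 1 (?S (n + k) m @ shift_word m (?S k n)) @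
        (run s 1 (k + 1 + n) m @ run s (m + 1) (k + 1) n))"
    by (rule yb_equiv_append_right[OF yb_equiv_shift[OF Suc.IH]])
  \<comment> \<open>Indices of at least \<open>m + 2\<close> pass indices of at most
    \<open>m\<close>. The run over \<open>M\<close> then completes the shuffle with
    \<open>M\<close>, and the run over \<open>N\<close> completes the shifted shuffle of
    \<open>K\<close> with \<open>N\<close>.\<close>
  have *: "yb_equiv X (shift_word (m + 1) (?S k n) @ run s 1 (k + 1 + n) m)
      (run s 1 (k + 1 + n) m @ shift_word (m + 1) (?S k n))"
    by (rule power_word_commute(2)[OF power_word_run power_word_shift[OF power_word_shuffle]]) auto
  have 3: "yb_equiv X (shift_word 1 (?S (n + k) m) @
        (shift_word (m + 1) (?S k n) @ run s 1 (k + 1 + n) m) @ run s (m + 1) (k + 1) n)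
      (shift_word 1 (?S (n + k) m) @
        (run s 1 (k + 1 + n) m @ shift_word (m + 1) (?S k n)) @ run s (m + 1) (k + 1) n)"
    by (rule yb_equiv_context[OF *])
  show ?case
    using 1 2 3 by (simp add: shuffle_word_Suc add.commute) (meson yb_equiv.trans)
qed simp

lemma Sigma_word_equiv:
  "yb_equiv X (Sigma_word s (m + n))
    (shuffle_word s n m @ Sigma_word s m @ shift_word m (Sigma_word s n))"
proof (induction n)
  case (Suc n)
  let ?S = "shuffle_word s" and ?T = "Sigma_word s"
  have 1: "yb_equiv X (?S 1 (m + n) @ ?T (m + n))
      (?S 1 (m + n) @ (?S n m @ ?T m @ shift_word m (?T n)))"
    by (rule yb_equiv_append_left[OF Suc.IH])
  \<comment> \<open>The shuffle identity with \<open>k = 1\<close>. Its shifted factor has indices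
    above \<open>m\<close>, so it then passes \<open>?T m\<close> and completes the second Sigma
    word.\<close>
  have 2: "yb_equiv X ((?S 1 (m + n) @ ?S n m) @ (?T m @ shift_word m (?T n)))
      ((?S (n + 1) m @ shift_word m (?S 1 n)) @ (?T m @ shift_word m (?T n)))"
    by (rule yb_equiv_append_right[OF shuffle_word_equiv])
  have *: "yb_equiv X (shift_word m (?S 1 n) @ ?T m) (?T m @ shift_word m (?S 1 n))"
    by (rule power_word_commute(2)[OF power_word_Sigma power_word_shift[OF power_word_shuffle]]) auto
  have 3: "yb_equiv X (?S (n + 1) m @ (shift_word m (?S 1 n) @ ?T m) @ shift_word m (?T n))
      (?S (n + 1) m @ (?T m @ shift_word m (?S 1 n)) @ shift_word m (?T n))"
    by (rule yb_equiv_context[OF *])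
  show ?case
    using 1 2 3 by (simp add: Sigma_word_Suc) (meson yb_equiv.trans)
qed (simp add: Sigma_word_0)

end

section \<open>Evaluation of words in an algebra\<close>

lemma word_prod_append: "word_prod \<tau> (v @ w) = word_prod \<tau> v * word_prod \<tau> w"
  by (simp add: word_prod_def)

lemma word_prod_equiv:
  assumes "\<forall>k\<ge>1. \<forall>x\<in>X. \<forall>y\<in>X. x * y \<in> X \<longrightarrow>
      \<tau> (k + 1) x * \<tau> k (x * y) * \<tau> (k + 1) y = \<tau> k y * \<tau> (k + 1) (x * y) * \<tau> k x"
    and "\<forall>k\<ge>1. \<forall>l\<ge>1. \<forall>x\<in>X. \<forall>y\<in>X. \<bar>int k - int l\<bar> > 1 \<longrightarrow> \<tau> k x * \<tau> l y = \<tau> l y * \<tau> k x"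
    and "yb_equiv X v w"
  shows "word_prod \<tau> v = word_prod \<tau> w"
  using assms(3)
proof (induction rule: yb_equiv.induct)
  case (yang_baxter k x y)
  then show ?case using assms(1)[rule_format, of k x y] by (simp add: word_prod_def mult.assoc)
next
  case (far_commute k l x y)
  then show ?case using assms(2)[rule_format, of k l x y] by (simp add: word_prod_def)
qed (simp_all add: word_prod_def)

section \<open>Graded algebra structures on direct sums\<close>

text \<open>Both sides run over the triples of degrees with sum \<open>N\<close>; on the left
  \<open>p\<close> is the sum of the first two.\<close>

lemma sum_triangle_assoc:
  fixes f :: "nat \<Rightarrow> nat \<Rightarrow> nat \<Rightarrow> 'a::comm_monoid_add"
  shows "(\<Sum>p\<le>N. \<Sum>m\<le>p. f m (p - m) (N - p)) = (\<Sum>m\<le>N. \<Sum>n\<le>N - m. f m n (N - m - n))"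
proof -
  have "(\<Sum>(p, m)\<in>(SIGMA p:{..N}. {..p}). f m (p - m) (N - p)) =
      (\<Sum>(m, n)\<in>(SIGMA m:{..N}. {..N - m}). f m n (N - m - n))"
    by (rule sum.reindex_bij_witness[of _ "\<lambda>(m, n). (m + n, m)" "\<lambda>(p, m). (m, p - m)"]) auto
  then show ?thesis
    by (simp add: sum.Sigma)
qed

text \<open>The algebra axioms are checked degree by degree. All hypotheses are restricted to the
  \<open>P j\<close> because \<open>tensor_prod\<close> is linear in its right argument only on
  tensor powers.\<close>

lemma graded_algebra_direct_sum:
  fixes scale :: "'k::field \<Rightarrow> 'a::ab_group_add \<Rightarrow> 'a" and \<mu> :: "nat \<Rightarrow> nat \<Rightarrow> 'a \<Rightarrow> 'a \<Rightarrow> 'a"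
  assumes V: "vector_space scale"
    and P: "\<And>j. module.subspace scale (P j)"
    and closed: "\<And>m n u v. u \<in> P m \<Longrightarrow> v \<in> P n \<Longrightarrow> \<mu> m n u v \<in> P (m + n)"
    and add_left: "\<And>m n u u' v. u \<in> P m \<Longrightarrow> u' \<in> P m \<Longrightarrow> v \<in> P n \<Longrightarrow>
      \<mu> m n (u + u') v = \<mu> m n u v + \<mu> m n u' v"
    and add_right: "\<And>m n u v v'. u \<in> P m \<Longrightarrow> v \<in> P n \<Longrightarrow> v' \<in> P n \<Longrightarrow>
      \<mu> m n u (v + v') = \<mu> m n u v + \<mu> m n u v'"
    and scale_left: "\<And>m n c u v. u \<in> P m \<Longrightarrow> v \<in> P n \<Longrightarrow> \<mu> m n (scale c u) v = scale c (\<mu> m n u v)"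
    and scale_right: "\<And>m n c u v. u \<in> P m \<Longrightarrow> v \<in> P n \<Longrightarrow> \<mu> m n u (scale c v) = scale c (\<mu> m n u v)"
    and assoc: "\<And>m n k u v w. u \<in> P m \<Longrightarrow> v \<in> P n \<Longrightarrow> w \<in> P k \<Longrightarrow>
      \<mu> (m + n) k (\<mu> m n u v) w = \<mu> m (n + k) u (\<mu> n k v w)"
    and e: "e \<in> P 0" "\<And>n u. u \<in> P n \<Longrightarrow> \<mu> 0 n e u = u" "\<And>n u. u \<in> P n \<Longrightarrow> \<mu> n 0 u e = u"
  shows "graded_algebra (fun_scale scale) (direct_sum P) (\<lambda>j. homog j ` P j)
    (\<lambda>u v N. \<Sum>m\<le>N. \<mu> m (N - m) (u m) (v (N - m))) (homog 0 e)"
proof -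
  interpret vector_space scale by fact
  interpret F: vector_space "fun_scale scale :: _ \<Rightarrow> (nat \<Rightarrow> 'a) \<Rightarrow> _"
    by (rule vector_space_fun_scale[OF V])
  have P0 [simp]: "0 \<in> P j" for j by (rule subspace_0[OF P])
  have Psum: "(\<And>i. i \<in> I \<Longrightarrow> f i \<in> P j) \<Longrightarrow> sum f I \<in> P j" for f :: "nat \<Rightarrow> 'a" and I j
    by (rule subspace_sum[OF P])
  have \<mu>0 [simp]: "\<mu> m n 0 v = 0" if "v \<in> P n" for m n v
    using scale_left[of 0 m v n 0] that by simp
  have \<mu>0' [simp]: "\<mu> m n u 0 = 0" if "u \<in> P m" for m n u
    using scale_right[of u m 0 n 0] that by simp
  have sum_left: "\<mu> m n (sum f I) v = (\<Sum>i\<in>I. \<mu> m n (f i) v)"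
    if "\<And>i. i \<in> I \<Longrightarrow> f i \<in> P m" "v \<in> P n" "finite I" for m n v and f :: "nat \<Rightarrow> 'a" and I
    using that(3,1) by (induction I rule: finite_induct) (simp_all add: add_left Psum that(2))
  have sum_right: "\<mu> m n u (sum f I) = (\<Sum>i\<in>I. \<mu> m n u (f i))"
    if "\<And>i. i \<in> I \<Longrightarrow> f i \<in> P n" "u \<in> P m" "finite I" for m n u and f :: "nat \<Rightarrow> 'a" and I
    using that(3,1) by (induction I rule: finite_induct) (simp_all add: add_right Psum that(2))
  have D: "u j \<in> P j" if "u \<in> direct_sum P" for u j
    using that by (simp add: direct_sum_def)
  have mem: "\<mu> m (N - m) (u m) (v (N - m)) \<in> P N"
    if "u \<in> direct_sum P" "v \<in> direct_sum P" "m \<le> N" for u v m N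
    using closed[of "u m" m "v (N - m)" "N - m"] that by (simp add: D)
  show ?thesis
  proof
    show "F.subspace (direct_sum P)"
      unfolding F.subspace_def
    proof (intro conjI ballI allI)
      fix x y assume "x \<in> direct_sum P" "y \<in> direct_sum P"
      moreover have "{j. (x + y) j \<noteq> 0} \<subseteq> {j. x j \<noteq> 0} \<union> {j. y j \<noteq> 0}" by auto
      ultimately show "x + y \<in> direct_sum P"
        by (auto simp: direct_sum_def subspace_add[OF P] intro: finite_subset)
    next
      fix x c assume "x \<in> direct_sum P"
      moreover have "{j. fun_scale scale c x j \<noteq> 0} \<subseteq> {j. x j \<noteq> 0}"
        by (auto simp: fun_scale_def)
      ultimately show "fun_scale scale c x \<in> direct_sum P"
        by (auto simp: direct_sum_def fun_scale_def subspace_scale[OF P] intro: finite_subset)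
    qed (simp add: direct_sum_def)
  next
    fix i
    show "F.subspace (homog i ` P i)"
      unfolding F.subspace_def
    proof (intro conjI ballI allI)
      show "0 \<in> homog i ` P i" by (rule image_eqI[of _ _ 0]) (auto simp: homog_def)
    next
      fix x y assume "x \<in> homog i ` P i" "y \<in> homog i ` P i"
      moreover have "homog i t + homog i u = homog i (t + u)" for t u :: 'a
        by (auto simp: homog_def fun_eq_iff)
      ultimately show "x + y \<in> homog i ` P i" using subspace_add[OF P] by auto
    next
      fix x c assume "x \<in> homog i ` P i"
      moreover have "fun_scale scale c (homog i t) = homog i (scale c t)" for t
        by (auto simp: homog_def fun_scale_def)
      ultimately show "fun_scale scale c x \<in> homog i ` P i" using subspace_scale[OF P] by auto
    qed
    show "homog i ` P i \<subseteq> direct_sum P"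
      by (auto simp: direct_sum_def homog_def)
  next
    fix a assume a: "a \<in> direct_sum P"
    have nz: "homog i (t :: 'a) \<noteq> 0 \<longleftrightarrow> t \<noteq> 0" for i t
      by (auto simp: homog_def fun_eq_iff)
    have sum_homog: "(\<Sum>i\<in>I. homog i (t i)) j = (if j \<in> I then t j else 0)"
      if "finite I" for I j and t :: "nat \<Rightarrow> 'a"
      using that by (induction I rule: finite_induct) (auto simp: homog_def)
    show "\<exists>!c. (\<forall>i. c i \<in> homog i ` P i) \<and> finite {i. c i \<noteq> 0} \<and> a = (\<Sum>i | c i \<noteq> 0. c i)"
    proof (rule ex1I[of _ "\<lambda>i. homog i (a i)"], intro conjI allI)
      show "homog i (a i) \<in> homog i ` P i" for i using D[OF a] by simp
      show fin: "finite {i. homog i (a i) \<noteq> 0}" using a by (simp only: nz) (simp add: direct_sum_def)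
      show "a = (\<Sum>i | homog i (a i) \<noteq> 0. homog i (a i))"
        by (rule ext) (subst sum_homog[OF fin], auto simp: nz simp del: zero_fun_apply)
    next
      \<comment> \<open>Uniqueness: every \<open>c i\<close> is concentrated in degree
        \<open>i\<close>, so evaluating the sum at \<open>j\<close> reads off the value of
        \<open>c j\<close> there.\<close>
      fix c
      assume c: "(\<forall>i. c i \<in> homog i ` P i) \<and> finite {i. c i \<noteq> 0} \<and> a = (\<Sum>i | c i \<noteq> 0. c i)"
      then have "\<forall>i. \<exists>t. c i = homog i t" by blast
      then obtain t where t: "\<And>i. c i = homog i (t i)" by metis
      have "a j = t j" for j
      proof -
        have eq: "a = (\<Sum>i | homog i (t i) \<noteq> 0. homog i (t i))" and fin: "finite {i. homog i (t i) \<noteq> 0}"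
          using c by (simp_all only: t)
        have "(\<Sum>i | homog i (t i) \<noteq> 0. homog i (t i)) j = t j"
          by (subst sum_homog[OF fin]) (auto simp: nz simp del: zero_fun_apply)
        with fun_cong[OF eq] show ?thesis by (rule HOL.trans)
      qed
      then show "c = (\<lambda>i. homog i (a i))" using t by auto
    qed
  next
    fix a b assume ab: "a \<in> direct_sum P" "b \<in> direct_sum P"
    let ?ab = "\<lambda>N. \<Sum>m\<le>N. \<mu> m (N - m) (a m) (b (N - m))"
    \<comment> \<open>Bounds on the degrees of the two factors add up to a bound on the degrees of
      the product.\<close>
    have "finite {j. a j \<noteq> 0}" "finite {j. b j \<noteq> 0}" using ab by (simp_all add: direct_sum_def)
    then obtain A B where AB: "\<And>j. a j \<noteq> 0 \<Longrightarrow> j \<le> A" "\<And>j. b j \<noteq> 0 \<Longrightarrow> j \<le> B"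
      unfolding finite_nat_set_iff_bounded_le by auto
    have "{N. ?ab N \<noteq> 0} \<subseteq> {..A + B}"
    proof (clarsimp)
      fix N assume "?ab N \<noteq> 0"
      then obtain m where m: "m \<le> N" "\<mu> m (N - m) (a m) (b (N - m)) \<noteq> 0"
        by (metis (no_types, lifting) atMost_iff sum.neutral)
      then have "a m \<noteq> 0" "b (N - m) \<noteq> 0" using D ab by (metis \<mu>0, metis \<mu>0')
      then show "N \<le> A + B" using AB(1)[of m] AB(2)[of "N - m"] m(1) by linarith
    qed
    then show "?ab \<in> direct_sum P"
      using mem[OF ab] by (auto simp: direct_sum_def intro!: Psum intro: finite_subset)
  next
    fix a a' b assume "a \<in> direct_sum P" "a' \<in> direct_sum P" "b \<in> direct_sum P"
    then show "(\<lambda>N. \<Sum>m\<le>N. \<mu> m (N - m) ((a + a') m) (b (N - m))) =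
        (\<lambda>N. \<Sum>m\<le>N. \<mu> m (N - m) (a m) (b (N - m))) + (\<lambda>N. \<Sum>m\<le>N. \<mu> m (N - m) (a' m) (b (N - m)))"
      by (simp add: fun_eq_iff add_left D sum.distrib)
  next
    fix a b b' assume "a \<in> direct_sum P" "b \<in> direct_sum P" "b' \<in> direct_sum P"
    then show "(\<lambda>N. \<Sum>m\<le>N. \<mu> m (N - m) (a m) ((b + b') (N - m))) =
        (\<lambda>N. \<Sum>m\<le>N. \<mu> m (N - m) (a m) (b (N - m))) + (\<lambda>N. \<Sum>m\<le>N. \<mu> m (N - m) (a m) (b' (N - m)))"
      by (simp add: fun_eq_iff add_right D sum.distrib)
  next
    fix a b c assume "a \<in> direct_sum P" "b \<in> direct_sum P"
    then show "(\<lambda>N. \<Sum>m\<le>N. \<mu> m (N - m) (fun_scale scale c a m) (b (N - m))) =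
        fun_scale scale c (\<lambda>N. \<Sum>m\<le>N. \<mu> m (N - m) (a m) (b (N - m)))"
      and "(\<lambda>N. \<Sum>m\<le>N. \<mu> m (N - m) (a m) (fun_scale scale c b (N - m))) =
        fun_scale scale c (\<lambda>N. \<Sum>m\<le>N. \<mu> m (N - m) (a m) (b (N - m)))"
      by (simp_all add: fun_eq_iff fun_scale_def scale_left scale_right D scale_sum_right)
  next
    fix a b d assume abd: "a \<in> direct_sum P" "b \<in> direct_sum P" "d \<in> direct_sum P"
    show "(\<lambda>N. \<Sum>p\<le>N. \<mu> p (N - p) (\<Sum>m\<le>p. \<mu> m (p - m) (a m) (b (p - m))) (d (N - p))) =
        (\<lambda>N. \<Sum>m\<le>N. \<mu> m (N - m) (a m) (\<Sum>n\<le>N - m. \<mu> n (N - m - n) (b n) (d (N - m - n))))"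
    proof
      fix N
      \<comment> \<open>The value in degrees \<open>m\<close>, \<open>n\<close>, \<open>k\<close>,
        bracketed to the right; \<open>assoc\<close> turns the left bracketing into it, so that both
        products are sums of \<open>f\<close> over the same triples.\<close>
      define f where "f m n k = \<mu> m (n + k) (a m) (\<mu> n k (b n) (d k))" for m n k
      have "\<mu> p (N - p) (\<Sum>m\<le>p. \<mu> m (p - m) (a m) (b (p - m))) (d (N - p)) =
          (\<Sum>m\<le>p. f m (p - m) (N - p))" for p
      proof -
        have "\<mu> p (N - p) (\<mu> m (p - m) (a m) (b (p - m))) (d (N - p)) = f m (p - m) (N - p)"
          if "m \<le> p" for m
          using assoc[of "a m" m "b (p - m)" "p - m" "d (N - p)" "N - p"] that abd by (simp add: f_def D)
        then show ?thesis
          using abd by (subst sum_left) (auto simp: D intro: mem)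
      qed
      moreover have "\<mu> m (N - m) (a m) (\<Sum>n\<le>N - m. \<mu> n (N - m - n) (b n) (d (N - m - n))) =
          (\<Sum>n\<le>N - m. f m n (N - m - n))" for m
        using abd by (subst sum_right) (simp_all add: D f_def mem del: diff_diff_left)
      ultimately show "(\<Sum>p\<le>N. \<mu> p (N - p) (\<Sum>m\<le>p. \<mu> m (p - m) (a m) (b (p - m))) (d (N - p))) =
          (\<Sum>m\<le>N. \<mu> m (N - m) (a m) (\<Sum>n\<le>N - m. \<mu> n (N - m - n) (b n) (d (N - m - n))))"
        by (simp add: sum_triangle_assoc)
    qed
  next
    fix a b i j assume "a \<in> homog i ` P i" "b \<in> homog j ` P j"
    then obtain u v where uv: "u \<in> P i" "v \<in> P j" "a = homog i u" "b = homog j v" by blast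
    have "(\<Sum>m\<le>N. \<mu> m (N - m) (a m) (b (N - m))) = homog (i + j) (\<mu> i j u v) N" for N
    proof -
      \<comment> \<open>A summand can survive only for \<open>m = i\<close> and
        \<open>N - m = j\<close>; the second condition is absorbed into
        \<open>homog (i + j)\<close>.\<close>
      have "\<mu> m (N - m) (a m) (b (N - m)) = (if m = i then homog (i + j) (\<mu> i j u v) N else 0)"
        if "m \<le> N" for m
        using uv that by (auto simp: homog_def)
      then have "(\<Sum>m\<le>N. \<mu> m (N - m) (a m) (b (N - m))) =
          (\<Sum>m\<le>N. if m = i then homog (i + j) (\<mu> i j u v) N else 0)"
        by (intro sum.cong) auto
      then show ?thesis by (simp add: homog_def)
    qed
    then show "(\<lambda>N. \<Sum>m\<le>N. \<mu> m (N - m) (a m) (b (N - m))) \<in> homog (i + j) ` P (i + j)"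
      using closed[OF uv(1,2)] by auto
  next
    show "homog 0 e \<in> homog 0 ` P 0" using e(1) by blast
  next
    fix a assume a: "a \<in> direct_sum P"
    show "(\<lambda>N. \<Sum>m\<le>N. \<mu> m (N - m) (homog 0 e m) (a (N - m))) = a"
    proof
      fix N
      have "(\<Sum>m\<le>N. \<mu> m (N - m) (homog 0 e m) (a (N - m))) = (\<Sum>m\<le>N. if m = 0 then a N else 0)"
        using a by (intro sum.cong) (auto simp: homog_def e D)
      then show "(\<Sum>m\<le>N. \<mu> m (N - m) (homog 0 e m) (a (N - m))) = a N" by simp
    qed
    show "(\<lambda>N. \<Sum>m\<le>N. \<mu> m (N - m) (a m) (homog 0 e (N - m))) = a"
    proof
      fix N
      have "(\<Sum>m\<le>N. \<mu> m (N - m) (a m) (homog 0 e (N - m))) = (\<Sum>m\<le>N. if m = N then a N else 0)"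
        using a by (intro sum.cong) (auto simp: homog_def e D)
      then show "(\<Sum>m\<le>N. \<mu> m (N - m) (a m) (homog 0 e (N - m))) = a N" by simp
    qed
  qed
qed


section \<open>Tensor products and local operators\<close>

lemma tensor_power_subspace: "tensor.subspace (tensor_power scale n)"
  by (simp add: tensor_power_def)

lemma pure_tensor_mem: "length vs = n \<Longrightarrow> pure_tensor scale vs \<in> tensor_power scale n"
  using pure_tensor_in_power[of scale vs] by simp

text \<open>The single condition on \<open>c x + y\<close> matches the step of
  \<open>tensor_power_induct\<close>, and it is only asked for inside the tensor power.\<close>

lemma tensor_power_eqI:
  fixes g h :: "('k::field, 'v::ab_group_add) tensor \<Rightarrow> ('k, 'v) tensor"
  assumes t: "t \<in> tensor_power scale n"
    and g: "\<And>c x y. x \<in> tensor_power scale n \<Longrightarrow> y \<in> tensor_power scale n \<Longrightarrow>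
      g (tensor_scale c x + y) = tensor_scale c (g x) + g y"
    and h: "\<And>c x y. x \<in> tensor_power scale n \<Longrightarrow> y \<in> tensor_power scale n \<Longrightarrow>
      h (tensor_scale c x + y) = tensor_scale c (h x) + h y"
    and eq: "\<And>vs. length vs = n \<Longrightarrow> g (pure_tensor scale vs) = h (pure_tensor scale vs)"
  shows "g t = h t"
  using t
proof (induction rule: tensor_power_induct)
  case zero
  have "0 \<in> tensor_power scale n" by (rule tensor.subspace_0[OF tensor_power_subspace])
  \<comment> \<open>With \<open>x = y = 0\<close> and \<open>c = 1\<close> the linearity condition
    reads \<open>g 0 = g 0 + g 0\<close>.\<close>
  then have "g 0 = 0" "h 0 = 0"
    using g[of 0 0 1] h[of 0 0 1] by (metis add_cancel_left_right tensor.scale_one)+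
  then show ?case by (simp only:)
next
  case (step c vs t)
  then show ?case
    using g h eq pure_tensor_in_power[of scale vs] by metis
qed

lemma local_op_linear:
  "local_op scale f k (t + u) = local_op scale f k t + local_op scale f k u"
  "local_op scale f k (tensor_scale c t) = tensor_scale c (local_op scale f k t)"
  by (simp_all add: local_op_def tensor_lift_linear)

context
  fixes scale :: "'k::field \<Rightarrow> 'v::ab_group_add \<Rightarrow> 'v"
  assumes V: "vector_space scale"
begin

text \<open>Linearity in the left factor is built into \<open>tensor_lift\<close>. On the right it
  becomes visible only through \<open>tensor_prod_pure_left\<close>, hence the reduction to a pure
  left factor.\<close>

lemma tensor_prod_right_linear:
  assumes t: "t \<in> tensor_power scale m" and u: "u \<in> tensor_power scale n" "u' \<in> tensor_power scale n"
  shows "tensor_prod scale t (tensor_scale c u + u') =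
    tensor_scale c (tensor_prod scale t u) + tensor_prod scale t u'"
proof (rule tensor_power_eqI[OF t])
  fix vs :: "'v list"
  have "tensor_scale c u + u' \<in> tensor_power scale n"
    using u by (intro tensor.subspace_add tensor.subspace_scale tensor_power_subspace)
  then show "tensor_prod scale (pure_tensor scale vs) (tensor_scale c u + u') =
      tensor_scale c (tensor_prod scale (pure_tensor scale vs) u) +
      tensor_prod scale (pure_tensor scale vs) u'"
    using u by (simp only: tensor_prod_pure_left[OF V] tensor_lift_linear)
qed (simp_all add: tensor_prod_left_linear tensor.scale_right_distrib tensor.scale_left_commute
    ac_simps del: plus_fun_apply)

lemma tensor_prod_closed:
  assumes "t \<in> tensor_power scale m" "u \<in> tensor_power scale n"
  shows "tensor_prod scale t u \<in> tensor_power scale (m + n)"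
  using assms(1)
proof (induction rule: tensor_power_induct)
  case zero
  show ?case
    unfolding tensor_prod_left_linear by (rule tensor.subspace_0[OF tensor_power_subspace])
next
  case (step c vs t)
  then show ?case
    using tensor_prod_pure_closed[OF V assms(2), of vs]
    unfolding tensor_prod_left_linear
    by (intro tensor.subspace_add tensor.subspace_scale tensor_power_subspace) simp_all
qed

text \<open>After reduction to pure tensors, one factor at a time, this is associativity of list
  concatenation.\<close>

lemma tensor_prod_assoc:
  assumes t: "t \<in> tensor_power scale m" and u: "u \<in> tensor_power scale n"
    and v: "v \<in> tensor_power scale k"
  shows "tensor_prod scale (tensor_prod scale t u) v = tensor_prod scale t (tensor_prod scale u v)"
proof (rule tensor_power_eqI[OF t])
  fix xs :: "'v list" assume xs: "length xs = m"
  let ?x = "pure_tensor scale xs"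
  show "tensor_prod scale (tensor_prod scale ?x u) v = tensor_prod scale ?x (tensor_prod scale u v)"
  proof (rule tensor_power_eqI[OF u])
    fix ys :: "'v list" assume ys: "length ys = n"
    let ?y = "pure_tensor scale ys"
    show "tensor_prod scale (tensor_prod scale ?x ?y) v = tensor_prod scale ?x (tensor_prod scale ?y v)"
    proof (rule tensor_power_eqI[OF v])
      fix zs :: "'v list"
      show "tensor_prod scale (tensor_prod scale ?x ?y) (pure_tensor scale zs) =
          tensor_prod scale ?x (tensor_prod scale ?y (pure_tensor scale zs))"
        by (simp add: tensor_prod_pure[OF V])
    qed (simp_all only: tensor_prod_right_linear[OF tensor_prod_closed[OF pure_tensor_in_power pure_tensor_in_power]]
        tensor_prod_right_linear[OF pure_tensor_in_power]
        tensor_prod_right_linear[OF pure_tensor_in_power tensor_prod_closed[OF pure_tensor_in_power]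
          tensor_prod_closed[OF pure_tensor_in_power]])
  qed (simp_all only: tensor_prod_right_linear[OF pure_tensor_in_power] tensor_prod_left_linear
      tensor_prod_right_linear[OF pure_tensor_in_power tensor_prod_closed[OF _ v] tensor_prod_closed[OF _ v]])
qed (simp_all only: tensor_prod_left_linear)

lemma tensor_prod_unit:
  assumes "t \<in> tensor_power scale n"
  shows "tensor_prod scale (pure_tensor scale []) t = t"
    and "tensor_prod scale t (pure_tensor scale []) = t"
  by (rule tensor_power_eqI[OF assms]; simp add: tensor_prod_right_linear[OF pure_tensor_in_power]
      tensor_prod_left_linear tensor_prod_pure[OF V] del: plus_fun_apply)+

lemma endomorphism_pair:
  assumes "is_endomorphism tensor_scale (tensor_power scale 2) f"
  shows "f (pure_tensor scale [v, w]) \<in> tensor_power scale 2"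
  using assms pure_tensor_mem[of "[v, w]" 2 scale] by (simp add: is_endomorphism_def)

lemma local_op_closed:
  assumes f: "is_endomorphism tensor_scale (tensor_power scale 2) f" and k: "1 \<le> k" "k < n"
    and t: "t \<in> tensor_power scale n"
  shows "local_op scale f k t \<in> tensor_power scale n"
  using t
proof (induction rule: tensor_power_induct)
  case zero
  show ?case
    unfolding local_op_def tensor_lift_linear by (rule tensor.subspace_0[OF tensor_power_subspace])
next
  case (step c vs t)
  have "local_op scale f k (pure_tensor scale vs) \<in>
      tensor_power scale (length (take (k - 1) vs) + 2 + length (drop (k + 1) vs))"
    using tensor_prod_closed[OF tensor_prod_closed[OF pure_tensor_in_power endomorphism_pair[OF f]]
        pure_tensor_in_power] k step(1)
    by (subst local_op_pure[OF V f]) (simp_all only:)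
  then have "local_op scale f k (pure_tensor scale vs) \<in> tensor_power scale n"
    using k step(1) by simp
  then show ?case
    unfolding local_op_linear using step
    by (intro tensor.subspace_add tensor.subspace_scale tensor_power_subspace)
qed

text \<open>As \<open>k < m\<close>, the positions \<open>k\<close> and \<open>k + 1\<close> both
  lie in the first factor; on pure tensors the second list is only appended to the untouched
  tail.\<close>

lemma local_op_prod_left:
  assumes f: "is_endomorphism tensor_scale (tensor_power scale 2) f" and k: "1 \<le> k" "k < m"
    and t: "t \<in> tensor_power scale m" and u: "u \<in> tensor_power scale n"
  shows "local_op scale f k (tensor_prod scale t u) = tensor_prod scale (local_op scale f k t) u"
proof (rule tensor_power_eqI[OF t])
  fix xs :: "'v list" assume xs: "length xs = m"
  show "local_op scale f k (tensor_prod scale (pure_tensor scale xs) u) =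
      tensor_prod scale (local_op scale f k (pure_tensor scale xs)) u"
  proof (rule tensor_power_eqI[OF u])
    fix ys :: "'v list" assume ys: "length ys = n"
    let ?p = "pure_tensor scale" and ?d = "drop (k + 1) xs"
    have "(xs @ ys) ! (k - 1) = xs ! (k - 1)"
      using k xs by (intro nth_append_left) simp
    then have "local_op scale f k (tensor_prod scale (?p xs) (?p ys)) = tensor_prod scale
       (tensor_prod scale (?p (take (k - 1) xs)) (f (?p [xs ! (k - 1), xs ! k]))) (?p (?d @ ys))"
      using k xs by (simp add: tensor_prod_pure[OF V] local_op_pure[OF V f] nth_append del: One_nat_def)
    also have "\<dots> = tensor_prod scale (local_op scale f k (?p xs)) (?p ys)"
      using k xs
      by (simp add: local_op_pure[OF V f] tensor_prod_pure[OF V, symmetric] tensor_prod_assoc[OF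
          tensor_prod_closed[OF pure_tensor_in_power endomorphism_pair[OF f]]
          pure_tensor_in_power pure_tensor_in_power] del: One_nat_def)
    finally show "local_op scale f k (tensor_prod scale (?p xs) (?p ys)) =
        tensor_prod scale (local_op scale f k (?p xs)) (?p ys)" .
  qed (simp_all only: tensor_prod_right_linear[OF pure_tensor_in_power] local_op_linear
      tensor_prod_right_linear[OF local_op_closed[OF f k pure_tensor_mem[OF xs]]])
qed (simp_all only: tensor_prod_left_linear local_op_linear)

lemma local_op_prod_right:
  assumes f: "is_endomorphism tensor_scale (tensor_power scale 2) f" and k: "1 \<le> k" "k < n"
    and t: "t \<in> tensor_power scale m" and u: "u \<in> tensor_power scale n"
  shows "local_op scale f (k + m) (tensor_prod scale t u) = tensor_prod scale t (local_op scale f k u)"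
proof (rule tensor_power_eqI[OF t])
  fix xs :: "'v list" assume xs: "length xs = m"
  show "local_op scale f (k + m) (tensor_prod scale (pure_tensor scale xs) u) =
      tensor_prod scale (pure_tensor scale xs) (local_op scale f k u)"
  proof (rule tensor_power_eqI[OF u])
    fix ys :: "'v list" assume ys: "length ys = n"
    let ?p = "pure_tensor scale" and ?d = "drop (k + 1) ys"
    let ?f = "f (?p [ys ! (k - 1), ys ! k])" and ?t = "take (k - 1) ys"
    \<comment> \<open>Position \<open>k + m\<close> of the concatenation is position
      \<open>k\<close> of \<open>ys\<close>; all of \<open>xs\<close> belongs to the untouched
      initial segment.\<close>
    have "take (k + m - 1) (xs @ ys) = xs @ ?t" "drop (k + m + 1) (xs @ ys) = ?d"
      "(xs @ ys) ! (k + m - 1) = ys ! (k - 1)" "(xs @ ys) ! (k + m) = ys ! k"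
      using k xs nth_append_length_plus[of xs ys "k - 1"] by (simp_all add: nth_append add.commute)
    then have "local_op scale f (k + m) (tensor_prod scale (?p xs) (?p ys)) =
        tensor_prod scale (tensor_prod scale (?p (xs @ ?t)) ?f) (?p ?d)"
      using k xs ys by (simp only: tensor_prod_pure[OF V]) (subst local_op_pure[OF V f], simp_all)
    also have "\<dots> = tensor_prod scale (tensor_prod scale (?p xs) (tensor_prod scale (?p ?t) ?f)) (?p ?d)"
      by (simp only: tensor_prod_pure[OF V, symmetric]
          tensor_prod_assoc[OF pure_tensor_in_power pure_tensor_in_power endomorphism_pair[OF f]])
    also have "\<dots> = tensor_prod scale (?p xs) (tensor_prod scale (tensor_prod scale (?p ?t) ?f) (?p ?d))"
      by (rule tensor_prod_assoc[OF pure_tensor_in_power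
            tensor_prod_closed[OF pure_tensor_in_power endomorphism_pair[OF f]] pure_tensor_in_power])
    also have "\<dots> = tensor_prod scale (?p xs) (local_op scale f k (?p ys))"
      using k ys by (subst local_op_pure[OF V f]) simp_all
    finally show "local_op scale f (k + m) (tensor_prod scale (?p xs) (?p ys)) =
        tensor_prod scale (?p xs) (local_op scale f k (?p ys))" .
  qed (simp_all only: tensor_prod_right_linear[OF pure_tensor_in_power] local_op_linear
      tensor_prod_right_linear[OF pure_tensor_in_power local_op_closed[OF f k] local_op_closed[OF f k]])
qed (simp_all only: tensor_prod_left_linear local_op_linear)

text \<open>Cut the tensor after factor \<open>l - 1\<close>. As \<open>k < l - 1\<close>, one
  operator acts in the left piece, the other in the first two factors of the right piece.\<close>

lemma local_op_commute:
  assumes f: "is_endomorphism tensor_scale (tensor_power scale 2) f"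
    and g: "is_endomorphism tensor_scale (tensor_power scale 2) g"
    and kl: "1 \<le> k" "k + 1 < l" "l < n" and t: "t \<in> tensor_power scale n"
  shows "local_op scale f k (local_op scale g l t) = local_op scale g l (local_op scale f k t)"
proof (rule tensor_power_eqI[OF t])
  fix vs :: "'v list" assume vs: "length vs = n"
  define a b where "a = pure_tensor scale (take (l - 1) vs)" and "b = pure_tensor scale (drop (l - 1) vs)"
  have a: "a \<in> tensor_power scale (l - 1)" and b: "b \<in> tensor_power scale (n - (l - 1))"
    using kl vs by (simp_all add: a_def b_def pure_tensor_mem)
  have v: "pure_tensor scale vs = tensor_prod scale a b"
    by (simp add: a_def b_def tensor_prod_pure[OF V])
  have l: "l = 1 + (l - 1)" using kl by simp
  have fa: "local_op scale f k a \<in> tensor_power scale (l - 1)"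
    by (rule local_op_closed[OF f _ _ a]) (use kl in auto)
  have gb: "local_op scale g 1 b \<in> tensor_power scale (n - (l - 1))"
    by (rule local_op_closed[OF g _ _ b]) (use kl in auto)
  have L: "local_op scale f k (tensor_prod scale a u) = tensor_prod scale (local_op scale f k a) u"
    if "u \<in> tensor_power scale (n - (l - 1))" for u
    by (rule local_op_prod_left[OF f _ _ a that]) (use kl in auto)
  have R: "local_op scale g l (tensor_prod scale u b) = tensor_prod scale u (local_op scale g 1 b)"
    if "u \<in> tensor_power scale (l - 1)" for u
    by (subst l, rule local_op_prod_right[OF g _ _ that b]) (use kl in auto)
  show "local_op scale f k (local_op scale g l (pure_tensor scale vs)) =
      local_op scale g l (local_op scale f k (pure_tensor scale vs))"
    by (simp only: v L R a b fa gb)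
qed (simp_all only: local_op_linear)

end

section \<open>b-shuffle algebras\<close>

lemma word_op_append: "word_op \<phi> (v @ w) t = word_op \<phi> v (word_op \<phi> w t)"
  by (simp add: word_op_def)

lemma word_op_simps [simp]:
  "word_op \<phi> [] t = t" "word_op \<phi> ((k, x) # w) t = \<phi> k x (word_op \<phi> w t)"
  by (simp_all add: word_op_def)

text \<open>The bound \<open>k + 2 \<le> N\<close> picks the degrees in which both indices
  \<open>k\<close> and \<open>k + 1\<close> act. Commutation of distant letters is supplied by
  \<open>local_op_commute\<close>.\<close>

locale yang_baxter_representation = vector_space scale
  for scale :: "'k::field \<Rightarrow> 'v::ab_group_add \<Rightarrow> 'v" +
  fixes X :: "'k set" and s :: 'k and \<sigma> :: "'k \<Rightarrow> ('k, 'v) tensor \<Rightarrow> ('k, 'v) tensor"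
  assumes powers: "\<forall>j\<ge>1. s ^ j \<in> X"
    and endomorphism: "x \<in> X \<Longrightarrow> is_endomorphism tensor_scale (tensor_power scale 2) (\<sigma> x)"
    and braid: "1 \<le> k \<Longrightarrow> x \<in> X \<Longrightarrow> y \<in> X \<Longrightarrow> x * y \<in> X \<Longrightarrow> k + 2 \<le> N \<Longrightarrow>
      t \<in> tensor_power scale N \<Longrightarrow>
      local_op scale (\<sigma> x) (k + 1) (local_op scale (\<sigma> (x * y)) k (local_op scale (\<sigma> y) (k + 1) t)) =
      local_op scale (\<sigma> y) k (local_op scale (\<sigma> (x * y)) (k + 1) (local_op scale (\<sigma> x) k t))"
begin

abbreviation act :: "(nat \<times> 'k) list \<Rightarrow> ('k, 'v) tensor \<Rightarrow> ('k, 'v) tensor" where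
  "act \<equiv> word_op (\<lambda>k x. local_op scale (\<sigma> x) k)"

text \<open>The letters that act on \<open>V\<^bsup>\<otimes>N\<^esup>\<close>; outside this range \<^const>\<open>local_op\<close> has junk values.\<close>

definition admissible :: "nat \<Rightarrow> (nat \<times> 'k) list \<Rightarrow> bool" where
  "admissible N w \<longleftrightarrow> (\<forall>(k, x)\<in>set w. 1 \<le> k \<and> k < N \<and> x \<in> X)"

lemma admissible_simps [simp]:
  "admissible N []"
  "admissible N ((k, x) # w) \<longleftrightarrow> (1 \<le> k \<and> k < N \<and> x \<in> X) \<and> admissible N w"
  "admissible N (v @ w) \<longleftrightarrow> admissible N v \<and> admissible N w"
  by (simp_all add: admissible_def ball_Un)

lemma admissible_power_word: "power_word s 1 N w \<Longrightarrow> admissible N w"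
  using powers by (auto simp: admissible_def power_word_def)

lemma admissible_shuffle: "admissible (m + n) (shuffle_word s n m)"
  using admissible_power_word[OF power_word_shuffle[of s n m]] by (simp add: add.commute)

lemma admissible_Sigma: "admissible m (Sigma_word s m)"
  by (rule admissible_power_word[OF power_word_Sigma])

lemma admissible_shift: "admissible n w \<Longrightarrow> admissible (m + n) (shift_word m w)"
  by (auto simp: admissible_def shift_word_def)

lemma admissible_mono: "admissible m w \<Longrightarrow> admissible (m + n) w"
  by (auto simp: admissible_def)

lemma act_linear:
  "act w (t + u) = act w t + act w u" "act w (tensor_scale c t) = tensor_scale c (act w t)"
  by (induction w) (auto simp only: word_op_simps local_op_linear split_paired_all)

lemma act_closed: "admissible N w \<Longrightarrow> t \<in> tensor_power scale N \<Longrightarrow> act w t \<in> tensor_power scale N"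
  by (induction w) (auto simp: local_op_closed[OF vector_space_axioms endomorphism])

lemma act_prod_left:
  assumes "admissible m w" "t \<in> tensor_power scale m" "u \<in> tensor_power scale n"
  shows "act w (tensor_prod scale t u) = tensor_prod scale (act w t) u"
  using assms(1)
  by (induction w)
    (auto simp: act_closed assms local_op_prod_left[OF vector_space_axioms endomorphism _ _ _ assms(3)])

lemma act_prod_right:
  assumes "admissible n w" "t \<in> tensor_power scale m" "u \<in> tensor_power scale n"
  shows "act (shift_word m w) (tensor_prod scale t u) = tensor_prod scale t (act w u)"
  using assms(1)
proof (induction w)
  case (Cons a w)
  obtain k x where "a = (k, x)" by (cases a)
  with Cons show ?case
    using local_op_prod_right[OF vector_space_axioms endomorphism _ _ assms(2) act_closed[OF _ assms(3)]]
    by (simp add: shift_word_def)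
qed simp

text \<open>Admissibility of the target is part of the claim: transitivity passes through
  intermediate words, and in \<open>append\<close> the left word acts on the result of the right
  one, which has to stay in the tensor power.\<close>

lemma act_equiv_admissible:
  "yb_equiv X v w \<Longrightarrow> admissible N v \<Longrightarrow>
    admissible N w \<and> (\<forall>t\<in>tensor_power scale N. act v t = act w t)"
proof (induction rule: yb_equiv.induct)
  case (append v v' w w')
  then show ?case by (auto simp: word_op_append act_closed)
next
  case (yang_baxter k x y)
  then show ?case using braid[of k x y N] by auto
next
  case (far_commute k l x y)
  consider "k + 1 < l" | "l + 1 < k" using far_commute by linarith
  then have "local_op scale (\<sigma> x) k (local_op scale (\<sigma> y) l t) =
      local_op scale (\<sigma> y) l (local_op scale (\<sigma> x) k t)"
    if "t \<in> tensor_power scale N" for t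
  proof cases
    case 1
    then show ?thesis
      using far_commute that by (intro local_op_commute[OF vector_space_axioms endomorphism endomorphism]) auto
  next
    case 2
    then show ?thesis
      using far_commute that
      by (intro local_op_commute[OF vector_space_axioms endomorphism endomorphism, symmetric]) auto
  qed
  with far_commute show ?case by simp
qed auto

lemma act_equiv:
  "yb_equiv X v w \<Longrightarrow> admissible N v \<Longrightarrow> t \<in> tensor_power scale N \<Longrightarrow> act v t = act w t"
  using act_equiv_admissible by blast

section \<open>The product in homogeneous degrees\<close>

lemma bshuffle_homog_closed:
  assumes "u \<in> tensor_power scale m" "v \<in> tensor_power scale n"
  shows "bshuffle_homog scale \<sigma> s m n u v \<in> tensor_power scale (m + n)"
  unfolding bshuffle_homog_def
  by (intro act_closed admissible_shuffle tensor_prod_closed[OF vector_space_axioms] assms)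

lemma bshuffle_homog_linear_left:
  "bshuffle_homog scale \<sigma> s m n (u + u') v =
    bshuffle_homog scale \<sigma> s m n u v + bshuffle_homog scale \<sigma> s m n u' v"
  "bshuffle_homog scale \<sigma> s m n (tensor_scale c u) v = tensor_scale c (bshuffle_homog scale \<sigma> s m n u v)"
  by (simp_all only: bshuffle_homog_def tensor_prod_left_linear act_linear)

lemma bshuffle_homog_linear_right:
  assumes "u \<in> tensor_power scale m" "v \<in> tensor_power scale n" "v' \<in> tensor_power scale n"
  shows "bshuffle_homog scale \<sigma> s m n u (tensor_scale c v + v') =
    tensor_scale c (bshuffle_homog scale \<sigma> s m n u v) + bshuffle_homog scale \<sigma> s m n u v'"
  by (simp only: bshuffle_homog_def tensor_prod_right_linear[OF vector_space_axioms assms] act_linear)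

lemma bshuffle_homog_add_right:
  assumes "u \<in> tensor_power scale m" "v \<in> tensor_power scale n" "v' \<in> tensor_power scale n"
  shows "bshuffle_homog scale \<sigma> s m n u (v + v') =
    bshuffle_homog scale \<sigma> s m n u v + bshuffle_homog scale \<sigma> s m n u v'"
  using bshuffle_homog_linear_right[OF assms, of 1] by (simp only: tensor.scale_one)

lemma bshuffle_homog_scale_right:
  assumes u: "u \<in> tensor_power scale m" and v: "v \<in> tensor_power scale n"
  shows "bshuffle_homog scale \<sigma> s m n u (tensor_scale c v) =
    tensor_scale c (bshuffle_homog scale \<sigma> s m n u v)"
proof -
  have 0: "0 \<in> tensor_power scale n" by (rule tensor.subspace_0[OF tensor_power_subspace])
  have "bshuffle_homog scale \<sigma> s m n u 0 = 0"
    using bshuffle_homog_add_right[OF u 0 0] by (simp only: add_0_left) (metis add_cancel_left_right)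
  then show ?thesis
    using bshuffle_homog_linear_right[OF u v 0, of c] by (simp only: add_0_right)
qed

lemma bshuffle_homog_assoc:
  assumes u: "u \<in> tensor_power scale m" and v: "v \<in> tensor_power scale n"
    and w: "w \<in> tensor_power scale k"
  shows "bshuffle_homog scale \<sigma> s (m + n) k (bshuffle_homog scale \<sigma> s m n u v) w =
    bshuffle_homog scale \<sigma> s m (n + k) u (bshuffle_homog scale \<sigma> s n k v w)"
proof -
  let ?S = "shuffle_word s" and ?p = "tensor_prod scale"
  note closed = tensor_prod_closed[OF vector_space_axioms]
  \<comment> \<open>The inner shuffle touches only the first \<open>m + n\<close> factors, so the
    left bracketing is one word acting on the triple tensor; in the right bracketing the inner
    shuffle is shifted by \<open>m\<close>.\<close>
  have "act (?S k (m + n)) (?p (act (?S n m) (?p u v)) w) =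
      act (?S k (m + n) @ ?S n m) (?p (?p u v) w)"
    by (simp only: word_op_append act_prod_left[OF admissible_shuffle closed[OF u v] w])
  also have "\<dots> = act (?S (n + k) m @ shift_word m (?S k n)) (?p (?p u v) w)"
    by (rule act_equiv[OF shuffle_word_equiv[OF powers] _ closed[OF closed[OF u v] w]])
      (simp add: admissible_mono admissible_shuffle)
  also have "\<dots> = act (?S (n + k) m) (?p u (act (?S k n) (?p v w)))"
    by (simp only: word_op_append tensor_prod_assoc[OF vector_space_axioms u v w]
        act_prod_right[OF admissible_shuffle u closed[OF v w]])
  finally show ?thesis
    by (simp only: bshuffle_homog_def)
qed

lemma bshuffle_homog_unit:
  assumes "u \<in> tensor_power scale n"
  shows "bshuffle_homog scale \<sigma> s 0 n (pure_tensor scale []) u = u"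
    and "bshuffle_homog scale \<sigma> s n 0 u (pure_tensor scale []) = u"
  by (simp_all add: bshuffle_homog_def tensor_prod_unit[OF vector_space_axioms assms])

section \<open>The images of the Sigma operators\<close>

lemma Sigma_image_subset: "Sigma_image scale \<sigma> s j \<subseteq> tensor_power scale j"
  using act_closed[OF admissible_Sigma] by (auto simp: Sigma_image_def)

lemma Sigma_image_subspace: "tensor.subspace (Sigma_image scale \<sigma> s j)"
proof -
  interpret TT: vector_space_pair "tensor_scale :: 'k \<Rightarrow> ('k, 'v) tensor \<Rightarrow> _"
      "tensor_scale :: 'k \<Rightarrow> ('k, 'v) tensor \<Rightarrow> _"
    by unfold_locales
  have "Vector_Spaces.linear tensor_scale tensor_scale (act (Sigma_word s j))"
    unfolding Vector_Spaces.linear_iff by (simp only: act_linear tensor.vector_space_axioms simp_thms)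
  then show ?thesis
    unfolding Sigma_image_def by (rule TT.linear_subspace_image[OF _ tensor_power_subspace])
qed

text \<open>By the factorisation of Sigma_{m+n}, the product of the images of \<open>a\<close> and
  \<open>b\<close> is the image of their tensor product.\<close>

lemma Sigma_image_closed:
  assumes "u \<in> Sigma_image scale \<sigma> s m" "v \<in> Sigma_image scale \<sigma> s n"
  shows "bshuffle_homog scale \<sigma> s m n u v \<in> Sigma_image scale \<sigma> s (m + n)"
proof -
  let ?S = "Sigma_word s" and ?p = "tensor_prod scale"
  obtain a b where a: "a \<in> tensor_power scale m" "u = act (?S m) a"
    and b: "b \<in> tensor_power scale n" "v = act (?S n) b"
    using assms by (auto simp: Sigma_image_def)
  have ab: "?p a b \<in> tensor_power scale (m + n)"
    by (rule tensor_prod_closed[OF vector_space_axioms a(1) b(1)])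
  have "act (?S (m + n)) (?p a b) =
      act (shuffle_word s n m @ ?S m @ shift_word m (?S n)) (?p a b)"
    by (rule act_equiv[OF Sigma_word_equiv[OF powers] admissible_Sigma ab])
  also have "\<dots> = bshuffle_homog scale \<sigma> s m n u v"
    by (simp only: word_op_append bshuffle_homog_def a b act_prod_right[OF admissible_Sigma a(1) b(1)]
        act_prod_left[OF admissible_Sigma a(1) act_closed[OF admissible_Sigma b(1)]])
  finally show ?thesis
    unfolding Sigma_image_def using ab by (metis image_eqI)
qed

text \<open>Serves the tensor powers and the Sigma images alike: linearity and associativity are
  inherited from the tensor powers, while closure and the unit depend on \<open>P\<close>.\<close>

lemma bshuffle_graded_algebra:
  assumes P: "\<And>j. tensor.subspace (P j)" "\<And>j. P j \<subseteq> tensor_power scale j"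
    and closed: "\<And>m n u v. u \<in> P m \<Longrightarrow> v \<in> P n \<Longrightarrow> bshuffle_homog scale \<sigma> s m n u v \<in> P (m + n)"
    and one: "pure_tensor scale [] \<in> P 0"
  shows "graded_algebra (fun_scale tensor_scale) (direct_sum P) (\<lambda>j. homog j ` P j)
    (bshuffle scale \<sigma> s) (homog 0 (pure_tensor scale []))"
proof -
  have P': "\<And>j t. t \<in> P j \<Longrightarrow> t \<in> tensor_power scale j" using P(2) by blast
  show ?thesis
    unfolding bshuffle_def
  proof (rule graded_algebra_direct_sum[where \<mu> = "bshuffle_homog scale \<sigma> s" and scale = tensor_scale,
        OF tensor.vector_space_axioms P(1)])
    fix m n k u v w assume "u \<in> P m" "v \<in> P n" "w \<in> P k"
    then show "bshuffle_homog scale \<sigma> s (m + n) k (bshuffle_homog scale \<sigma> s m n u v) w =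
        bshuffle_homog scale \<sigma> s m (n + k) u (bshuffle_homog scale \<sigma> s n k v w)"
      by (intro bshuffle_homog_assoc P')
  qed (simp_all only: closed one bshuffle_homog_linear_left bshuffle_homog_add_right[OF P' P' P']
      bshuffle_homog_scale_right[OF P' P'] bshuffle_homog_unit[OF P'])
qed

lemma tensor_graded_algebra:
  "graded_algebra (fun_scale tensor_scale)
    (direct_sum (tensor_power scale)) (\<lambda>j. homog j ` tensor_power scale j)
    (bshuffle scale \<sigma> s) (homog 0 (pure_tensor scale []))"
  by (rule bshuffle_graded_algebra[OF tensor_power_subspace _ bshuffle_homog_closed])
    (simp_all add: pure_tensor_mem)

lemma Sigma_graded_subalgebra:
  "graded_subalgebra (fun_scale tensor_scale)
    (direct_sum (Sigma_image scale \<sigma> s)) (\<lambda>j. homog j ` Sigma_image scale \<sigma> s j)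
    (direct_sum (tensor_power scale)) (\<lambda>j. homog j ` tensor_power scale j)
    (bshuffle scale \<sigma> s) (homog 0 (pure_tensor scale []))"
  unfolding graded_subalgebra_def
proof (intro conjI allI tensor_graded_algebra)
  let ?I = "Sigma_image scale \<sigma> s"
  \<comment> \<open>\<open>homog i t\<close> has the default value 0 outside degree
    \<open>i\<close>, and this has to lie in the other images.\<close>
  have zero: "0 \<in> ?I j" for j by (rule tensor.subspace_0[OF Sigma_image_subspace])
  show "direct_sum ?I \<subseteq> direct_sum (tensor_power scale)"
    using Sigma_image_subset by (auto simp: direct_sum_def)
  show "homog i ` ?I i = direct_sum ?I \<inter> homog i ` tensor_power scale i" for i
  proof (intro equalityI subsetI)
    fix x assume "x \<in> homog i ` ?I i"
    then obtain t where t: "t \<in> ?I i" "x = homog i t" by blast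
    have "finite {j. homog i t j \<noteq> 0}"
      by (rule finite_subset[of _ "{i}"]) (auto simp: homog_def)
    moreover have "homog i t j \<in> ?I j" for j
      using t(1) zero by (cases "j = i") (simp_all only: homog_def if_True if_False simp_thms)
    ultimately show "x \<in> direct_sum ?I \<inter> homog i ` tensor_power scale i"
      using t Sigma_image_subset by (auto simp: direct_sum_def)
  next
    fix x assume x: "x \<in> direct_sum ?I \<inter> homog i ` tensor_power scale i"
    then obtain t where t: "x = homog i t" by blast
    have "x i \<in> ?I i" using x by (simp add: direct_sum_def)
    then have "t \<in> ?I i" by (simp add: t homog_def)
    then show "x \<in> homog i ` ?I i" using t by blast
  qed
  \<comment> \<open>The Sigma word of degree 0 is empty and acts as the identity, so the unit is its
    own image.\<close>
  have "pure_tensor scale [] \<in> ?I 0"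
    by (simp add: Sigma_image_def Sigma_word_0 pure_tensor_mem)
  then show "graded_algebra (fun_scale tensor_scale) (direct_sum ?I) (\<lambda>j. homog j ` ?I j)
      (bshuffle scale \<sigma> s) (homog 0 (pure_tensor scale []))"
    by (intro bshuffle_graded_algebra Sigma_image_subspace Sigma_image_subset Sigma_image_closed)
qed

end

theorem mainTheorem1:
  fixes s :: "'k::field" and X :: "'k set"
    and scaleA :: "'k \<Rightarrow> 'a::{ring, monoid_mult} \<Rightarrow> 'a"
    and \<tau> :: "nat \<Rightarrow> 'k \<Rightarrow> 'a"
    and scaleV :: "'k \<Rightarrow> 'v::ab_group_add \<Rightarrow> 'v"
    and \<sigma> :: "'k \<Rightarrow> ('k, 'v) tensor \<Rightarrow> ('k, 'v) tensor"
  assumes "s \<noteq> 0" and "0 \<notin> X" and "\<forall>j\<ge>1. s ^ j \<in> X"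
  shows
    "(unital_algebra scaleA \<and>
      (\<forall>k\<ge>1. \<forall>x\<in>X. \<forall>y\<in>X. x * y \<in> X \<longrightarrow>
         \<tau> (k + 1) x * \<tau> k (x * y) * \<tau> (k + 1) y = \<tau> k y * \<tau> (k + 1) (x * y) * \<tau> k x) \<and>
      (\<forall>k\<ge>1. \<forall>l\<ge>1. \<forall>x\<in>X. \<forall>y\<in>X. \<bar>int k - int l\<bar> > 1 \<longrightarrow> \<tau> k x * \<tau> l y = \<tau> l y * \<tau> k x)
      \<longrightarrow>
      (\<forall>m n k.
         word_prod \<tau> (shuffle_word s (n + k) m) * word_prod \<tau> (shift_word m (shuffle_word s k n)) =
         word_prod \<tau> (shuffle_word s k (m + n)) * word_prod \<tau> (shuffle_word s n m)))
     \<and>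
     (vector_space scaleV \<and>
      (\<forall>x\<in>X. is_endomorphism tensor_scale (tensor_power scaleV 2) (\<sigma> x)) \<and>
      (\<forall>k\<ge>1. \<forall>x\<in>X. \<forall>y\<in>X. x * y \<in> X \<longrightarrow> (\<forall>N\<ge>k + 2. \<forall>t\<in>tensor_power scaleV N.
         local_op scaleV (\<sigma> x) (k + 1) (local_op scaleV (\<sigma> (x * y)) k (local_op scaleV (\<sigma> y) (k + 1) t)) =
         local_op scaleV (\<sigma> y) k (local_op scaleV (\<sigma> (x * y)) (k + 1) (local_op scaleV (\<sigma> x) k t))))
      \<longrightarrow>
      graded_algebra (fun_scale tensor_scale)
        (direct_sum (tensor_power scaleV)) (\<lambda>j. homog j ` tensor_power scaleV j)
        (bshuffle scaleV \<sigma> s) (homog 0 (pure_tensor scaleV [])) \<and>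
      graded_subalgebra (fun_scale tensor_scale)
        (direct_sum (Sigma_image scaleV \<sigma> s)) (\<lambda>j. homog j ` Sigma_image scaleV \<sigma> s j)
        (direct_sum (tensor_power scaleV)) (\<lambda>j. homog j ` tensor_power scaleV j)
        (bshuffle scaleV \<sigma> s) (homog 0 (pure_tensor scaleV [])))"
proof (intro conjI impI; (elim conjE)?)
  assume "\<forall>k\<ge>1. \<forall>x\<in>X. \<forall>y\<in>X. x * y \<in> X \<longrightarrow>
      \<tau> (k + 1) x * \<tau> k (x * y) * \<tau> (k + 1) y = \<tau> k y * \<tau> (k + 1) (x * y) * \<tau> k x"
    and "\<forall>k\<ge>1. \<forall>l\<ge>1. \<forall>x\<in>X. \<forall>y\<in>X. \<bar>int k - int l\<bar> > 1 \<longrightarrow> \<tau> k x * \<tau> l y = \<tau> l y * \<tau> k x"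
  from word_prod_equiv[OF this shuffle_word_equiv[OF assms(3)]]
  show "\<forall>m n k.
      word_prod \<tau> (shuffle_word s (n + k) m) * word_prod \<tau> (shift_word m (shuffle_word s k n)) =
      word_prod \<tau> (shuffle_word s k (m + n)) * word_prod \<tau> (shuffle_word s n m)"
    by (simp add: word_prod_append)
next
  assume rep: "vector_space scaleV"
    "\<forall>x\<in>X. is_endomorphism tensor_scale (tensor_power scaleV 2) (\<sigma> x)"
    "\<forall>k\<ge>1. \<forall>x\<in>X. \<forall>y\<in>X. x * y \<in> X \<longrightarrow> (\<forall>N\<ge>k + 2. \<forall>t\<in>tensor_power scaleV N.
       local_op scaleV (\<sigma> x) (k + 1) (local_op scaleV (\<sigma> (x * y)) k (local_op scaleV (\<sigma> y) (k + 1) t)) =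
       local_op scaleV (\<sigma> y) k (local_op scaleV (\<sigma> (x * y)) (k + 1) (local_op scaleV (\<sigma> x) k t)))"
  interpret vector_space scaleV by fact
  interpret yang_baxter_representation scaleV X s \<sigma>
    by unfold_locales (use assms(3) rep(2,3) in blast)+
  show "graded_algebra (fun_scale tensor_scale)
      (direct_sum (tensor_power scaleV)) (\<lambda>j. homog j ` tensor_power scaleV j)
      (bshuffle scaleV \<sigma> s) (homog 0 (pure_tensor scaleV []))"
    by (rule tensor_graded_algebra)
  show "graded_subalgebra (fun_scale tensor_scale)
      (direct_sum (Sigma_image scaleV \<sigma> s)) (\<lambda>j. homog j ` Sigma_image scaleV \<sigma> s j)
      (direct_sum (tensor_power scaleV)) (\<lambda>j. homog j ` tensor_power scaleV j)
      (bshuffle scaleV \<sigma> s) (homog 0 (pure_tensor scaleV []))"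
    by (rule Sigma_graded_subalgebra)
qed

end
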